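(* Fix $0<r<1$. There does not exist a constant $C_r<\infty$, depending only on $r$, such that for every dimension $N\ge 1$ and every finite nonempty set $T\subset\mathbb{R}^N$ one can find a sequence $(y_k)_{k\ge 1}\subset\mathbb{R}^N$ satisfying \[ T-T\subset \operatorname{absconv}\{y_k:k\ge 1\} \qquad\text{and}\qquad \|X_{y_k}\|_{L_{\log(k+2)}}\le C_r\, b_X(T)\quad\text{for all } k\ge 1 . \]
   Context: A real random variable $\xi$ is called symmetric Weibull$(r)$ if $\xi$ is symmetric (i.e. $\xi$ and $-\xi$ have the same law) and $\mathsf{P}(|\xi|>t)=e^{-t^r}$ for all $t\ge 0$. For a dimension $N$, let $X=(X_1,\dots,X_N)$ have independent symmetric Weibull$(r)$ coordinates, and for $t\in\mathbb{R}^N$ put $X_t=\sum_{i=1}^N t_iX_i$. For a finite nonempty set $T\subset\mathbb{R}^N$ put $b_X(T)=\mathsf{E}\sup_{t\in T}X_t$ and $T-T=\{s-t:s,t\in T\}$. For a real random variable $Z$ and $p\ge 1$, $\|Z\|_{L_p}=(\mathsf{E}|Z|^p)^{1/p}$; $\log$ is the natural logarithm. For $A\subset\mathbb{R}^N$, \[ \operatorname{absconv}(A)=\Bigl\{\sum_{j=1}^m a_j a^{(j)}: m<\infty,\ a^{(j)}\in A,\ a_j\in\mathbb{R},\ \sum_{j=1}^m|a_j|\le 1\Bigr\}. \] *)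

theory Defs
  imports "HOL-Analysis.Abstract_Euclidean_Space" "HOL-Probability.Probability"
begin

text \<open>The dimension \<open>N\<close> is quantified inside the statement, so \<open>\<real>\<^sup>N\<close> is the carrier
  \<^term>\<open>topspace (Euclidean_space N)\<close>: the functions \<^typ>\<open>nat \<Rightarrow> real\<close> that vanish at all
  indices \<open>\<ge> N\<close>. Coordinates are thus numbered \<open>0, \<dots>, N - 1\<close>.\<close>

definition symmetric_weibull :: "'a measure \<Rightarrow> real \<Rightarrow> ('a \<Rightarrow> real) \<Rightarrow> bool" where
  "symmetric_weibull M r \<xi> \<longleftrightarrow>
     \<xi> \<in> borel_measurable M \<and>
     distr M borel \<xi> = distr M borel (\<lambda>\<omega>. - \<xi> \<omega>) \<and>
     (\<forall>t\<ge>0. measure M {\<omega> \<in> space M. \<bar>\<xi> \<omega>\<bar> > t} = exp (- (t powr r)))"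

definition lin_comb :: "nat \<Rightarrow> (nat \<Rightarrow> 'a \<Rightarrow> real) \<Rightarrow> (nat \<Rightarrow> real) \<Rightarrow> 'a \<Rightarrow> real" where
  "lin_comb N X t \<omega> = (\<Sum>i<N. t i * X i \<omega>)"

text \<open>Used only for finite nonempty \<open>T\<close>, where the supremum is a maximum.\<close>

definition exp_sup :: "'a measure \<Rightarrow> nat \<Rightarrow> (nat \<Rightarrow> 'a \<Rightarrow> real) \<Rightarrow> (nat \<Rightarrow> real) set \<Rightarrow> real" where
  "exp_sup M N X T = (\<integral>\<omega>. (SUP t\<in>T. lin_comb N X t \<omega>) \<partial>M)"

text \<open>The integral is Bochner's, which is \<open>0\<close> when \<open>\<bar>Z\<bar>\<^sup>p\<close> is not integrable. Linear combinations
  of symmetric Weibull variables have finite moments of every order, so there it is the usual norm.\<close>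

definition Lp_norm :: "'a measure \<Rightarrow> real \<Rightarrow> ('a \<Rightarrow> real) \<Rightarrow> real" where
  "Lp_norm M p Z = (\<integral>\<omega>. \<bar>Z \<omega>\<bar> powr p \<partial>M) powr (1 / p)"

definition difference_set :: "(nat \<Rightarrow> real) set \<Rightarrow> (nat \<Rightarrow> real) set" where
  "difference_set T = {(\<lambda>i. s i - t i) | s t. s \<in> T \<and> t \<in> T}"

definition absconv :: "(nat \<Rightarrow> real) set \<Rightarrow> (nat \<Rightarrow> real) set" where
  "absconv A = {(\<lambda>i. \<Sum>j=1..m. a j * v j i) | (m::nat) (a :: nat \<Rightarrow> real) v.
     (\<forall>j\<in>{1..m}. v j \<in> A) \<and> (\<Sum>j=1..m. \<bar>a j\<bar>) \<le> 1}"

text \<open>Independent symmetric Weibull variables exist, and one probability space carries them for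
  all dimensions at once. A symmetric Weibull variable is realised as a fair random sign times
  \<open>E\<^sup>1\<^sup>/\<^sup>r\<close> with \<open>E\<close> standard exponential.\<close>

lemma symmetric_weibull_exists:
  assumes r: "0 < (r::real)"
  obtains P :: "(bool \<times> real) measure" and Z where "prob_space P" "symmetric_weibull P r Z"
proof -
  define B where "B = measure_pmf (bernoulli_pmf (1/2))"
  define E where "E = density lborel (exponential_density 1)"
  define P where "P = B \<Otimes>\<^sub>M E"
  define Z :: "bool \<times> real \<Rightarrow> real" where
    "Z = (\<lambda>(b, x). (if b then 1 else -1) * max 0 x powr (1/r))"
  interpret B: prob_space B unfolding B_def by (rule prob_space_measure_pmf)
  interpret E: prob_space E unfolding E_def by (rule prob_space_exponential_density) simp
  interpret P: pair_prob_space B E ..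
  have [measurable_cong]: "sets B = sets (count_space UNIV)" by (simp add: B_def)
  have [measurable_cong]: "sets E = sets borel" by (simp add: E_def)
  have Zm[measurable]: "Z \<in> borel_measurable P" unfolding Z_def P_def by measurable
  have BN: "distr B B Not = B"
  proof -
    have "map_pmf Not (bernoulli_pmf (1/2)) = bernoulli_pmf (1/2)"
    proof (rule pmf_eqI)
      fix b :: bool
      have "pmf (map_pmf Not (bernoulli_pmf (1/2))) (Not (Not b)) = pmf (bernoulli_pmf (1/2)) (Not b)"
        by (rule pmf_map_inj') (simp add: inj_def)
      thus "pmf (map_pmf Not (bernoulli_pmf (1/2))) b = pmf (bernoulli_pmf (1/2)) b"
        by (cases b) simp_all
    qed
    hence "measure_pmf (map_pmf Not (bernoulli_pmf (1/2))) = measure_pmf (bernoulli_pmf (1/2))" by simp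
    thus ?thesis unfolding B_def map_pmf_rep_eq
      by (metis (no_types) distr_cong sets_measure_pmf_count_space)
  qed
  have "distr P P (\<lambda>(b,x). (Not b, id x)) = distr B B Not \<Otimes>\<^sub>M distr E E id"
    unfolding P_def by (rule pair_measure_distr[symmetric]) (auto simp: B_def id_def E.sigma_finite_measure)
  also have "\<dots> = P" by (simp add: BN P_def id_def)
  finally have dP: "distr P P (\<lambda>(b,x). (Not b, id x)) = P" .
  have m: "(\<lambda>(b,x). (Not b, id x)) \<in> measurable P P"
    unfolding P_def id_def case_prod_unfold
    by (intro measurable_Pair measurable_compose[OF measurable_fst] measurable_compose[OF measurable_snd])
       (auto simp: B_def)
  have "distr P borel Z = distr (distr P P (\<lambda>(b,x). (Not b, id x))) borel Z" by (simp only: dP)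
  also have "\<dots> = distr P borel (Z \<circ> (\<lambda>(b,x). (Not b, id x)))" by (rule distr_distr[OF Zm m])
  also have "Z \<circ> (\<lambda>(b,x). (Not b, id x)) = (\<lambda>\<omega>. - Z \<omega>)" by (auto simp: Z_def fun_eq_iff)
  finally have sym: "distr P borel Z = distr P borel (\<lambda>\<omega>. - Z \<omega>)" .
  have tail: "measure P {\<omega> \<in> space P. \<bar>Z \<omega>\<bar> > t} = exp (- (t powr r))" if t: "t \<ge> 0" for t
  proof -
    have iff: "max 0 x powr (1/r) > t \<longleftrightarrow> x > t powr r" for x
    proof (cases "x \<le> 0")
      case True
      then have "max 0 x = 0" by simp
      moreover have "\<not> x > t powr r" using True powr_ge_zero[of t r] by linarith
      ultimately show ?thesis using t by simp
    next
      case False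
      hence x: "max 0 x = x" "x > 0" by auto
      have "x powr (1/r) > t \<longleftrightarrow> (x powr (1/r)) powr r > t powr r"
        using t r x by (metis linorder_not_le powr_ge_zero powr_less_mono2 powr_mono2 less_imp_le)
      also have "(x powr (1/r)) powr r = x" using r x by (simp add: powr_powr)
      finally show ?thesis using x by simp
    qed
    have "{\<omega> \<in> space P. \<bar>Z \<omega>\<bar> > t} = UNIV \<times> {x. x > t powr r}"
      by (auto simp: Z_def P_def B_def E_def space_pair_measure abs_mult iff split: if_splits)
    also have "measure P \<dots> = measure B UNIV * measure E {x. x > t powr r}"
      unfolding P_def measure_def
      by (subst E.emeasure_pair_measure_Times) (auto simp: B_def E_def enn2real_mult)
    also have "measure B UNIV = 1" by (simp add: B_def)
    also have "measure E {x. x > t powr r} = exp (- (t powr r))"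
    proof -
      have "distributed E lborel (\<lambda>x. x) (exponential_density 1)"
        by (auto simp: distributed_def E_def distr_id2 exponential_density_nonneg)
      from E.exponential_distributedD_gt[OF this, of "t powr r"] show ?thesis by (simp add: E_def)
    qed
    finally show ?thesis by simp
  qed
  have "prob_space P" unfolding P_def by (rule P.prob_space_axioms)
  moreover have "symmetric_weibull P r Z" unfolding symmetric_weibull_def using sym tail Zm by blast
  ultimately show ?thesis by (rule that)
qed

lemma iid_symmetric_weibull_exists:
  assumes r: "0 < (r::real)"
  obtains M :: "(nat \<Rightarrow> real) measure" and X where "prob_space M"
    "prob_space.indep_vars M (\<lambda>_. borel) X (UNIV::nat set)" "\<And>i. symmetric_weibull M r (X i)"
proof -
  obtain P :: "(bool \<times> real) measure" and Z where P: "prob_space P" and Z: "symmetric_weibull P r Z"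
    by (rule symmetric_weibull_exists[OF r])
  interpret P: prob_space P by (rule P)
  have Zm[measurable]: "Z \<in> borel_measurable P" using Z by (simp add: symmetric_weibull_def)
  define D where "D = distr P borel Z"
  have D: "prob_space D" unfolding D_def by (rule P.prob_space_distr) (rule Zm)
  have sD[measurable_cong, simp]: "sets D = sets borel" "space D = UNIV" by (simp_all add: D_def)
  have iD[measurable]: "(\<lambda>x. x) \<in> borel_measurable D"
    using measurable_ident_sets[OF sD(1)] by simp
  have wD: "symmetric_weibull D r (\<lambda>x. x)"
  proof -
    have "distr D borel (\<lambda>x. x) = D" by (rule distr_id2) (simp)
    moreover have "distr D borel (\<lambda>x. - x) = distr P borel (\<lambda>\<omega>. - Z \<omega>)"
      by (simp add: D_def distr_distr comp_def)
    moreover have "measure D {x. \<bar>x\<bar> > t} = measure P {\<omega>\<in>space P. \<bar>Z \<omega>\<bar> > t}" for t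
      unfolding D_def by (subst measure_distr) (auto intro!: arg_cong[where f="measure P"])
    ultimately show ?thesis using Z by (auto simp: symmetric_weibull_def D_def)
  qed
  define M where "M = PiM (UNIV::nat set) (\<lambda>_. D)"
  interpret M: prob_space M unfolding M_def by (rule prob_space_PiM) (rule D)
  have c: "distr M D (\<lambda>\<omega>. \<omega> i) = D" for i
    unfolding M_def by (rule distr_PiM_component) (auto simp: D)
  have mc[measurable]: "(\<lambda>\<omega>. \<omega> i) \<in> measurable M D" for i unfolding M_def by simp
  have mb[measurable]: "(\<lambda>\<omega>. \<omega> i) \<in> borel_measurable M" for i
    using mc[of i] measurable_cong_sets[OF refl sD(1), of M] by blast
  have cb: "distr M borel (\<lambda>\<omega>. \<omega> i) = D" for i using c[of i] by (metis distr_cong sD(1))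
  have "M.indep_vars (\<lambda>_. borel) (\<lambda>i \<omega>. \<omega> i) (UNIV::nat set)"
  proof (subst M.indep_vars_iff_distr_eq_PiM)
    show "(UNIV::nat set) \<noteq> {}" by simp
    show "M.random_variable borel (\<lambda>\<omega>. \<omega> i)" for i
      by (rule mb)
    have "distr M (PiM UNIV (\<lambda>_. borel)) (\<lambda>x. \<lambda>i\<in>UNIV. x i) = M"
      by (subst restrict_UNIV, rule distr_id2) (unfold M_def, rule sets_PiM_cong, simp_all)
    thus "distr M (PiM UNIV (\<lambda>_. borel)) (\<lambda>x. \<lambda>i\<in>UNIV. x i)
       = PiM UNIV (\<lambda>i. distr M borel (\<lambda>\<omega>. \<omega> i))"
      unfolding cb by (simp only: M_def)
  qed
  moreover have "symmetric_weibull M r (\<lambda>\<omega>. \<omega> i)" for i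
  proof -
    have "distr M borel (\<lambda>\<omega>. - \<omega> i) = distr D borel (\<lambda>x. - x)"
      by (subst c[of i, symmetric], subst distr_distr[OF _ mc]) (auto simp: comp_def)
    moreover have "measure M {\<omega>\<in>space M. \<bar>\<omega> i\<bar> > t} = measure D {x. \<bar>x\<bar> > t}" for t
      by (subst c[of i, symmetric], subst measure_distr[OF mc]) (auto intro!: arg_cong[where f="measure M"])
    moreover have "distr D borel (\<lambda>x. x) = D" by (rule distr_id2) simp
    ultimately show ?thesis using wD mb[of i] cb[of i]
      by (simp add: symmetric_weibull_def)
  qed
  ultimately show ?thesis by (intro that[of M "\<lambda>i \<omega>. \<omega> i"] M.prob_space_axioms)
qed

end

theory Submission
  imports Defs
begin

text \<open>For \<open>r < 1\<close> one has \<open>\<parallel>X\<^sub>t\<parallel>\<^sub>q \<ge> q\<^sup>1\<^sup>/\<^sup>r max\<^sub>i \<bar>t\<^sub>i\<bar> / e\<close>, but a sum over many coordinates is large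
  mostly because of many moderately large terms and not because of a single huge one. Let \<open>T\<close>
  consist of \<open>0\<close> and the indicators of the \<open>m\<close>-point graphs of \<open>Q\<^sup>d\<close> polynomials of degree \<open>< d\<close>, where
  \<open>m = A d\<close>. A union bound gives \<open>b\<^sub>X(T) \<lesssim> d L\<^sup>1\<^sup>/\<^sup>r\<close> with \<open>L = ln N\<close>. If \<open>T - T\<close> were contained in the
  absolutely convex hull of admissible \<open>y\<^sub>k\<close>, then each graph \<open>S\<close> would have some \<open>k\<close> with
  \<open>\<Sum>\<^bsub>i\<in>S\<^esub> \<bar>y\<^sub>k i\<bar> \<ge> m\<close>. For \<open>q = ln (k + 2)\<close> the entries of \<open>y\<^sub>k\<close> are \<open>O(d (L/q)\<^sup>1\<^sup>/\<^sup>r)\<close>, so if \<open>A\<close> is large,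
  \<open>S\<close> must contain about \<open>q/L\<close> points of the small set of coordinates where \<open>\<bar>y\<^sub>k\<bar> \<ge> 1/2\<close>. Since
  polynomials with prescribed values are rare, at most a fraction \<open>(k + 2)\<^sup>-\<^sup>2\<close> of the graphs does so,
  and if \<open>q \<ge> d L/8\<close> none does because then \<open>\<bar>y\<^sub>k\<bar> < 1\<close>, \<open>d\<close> being large. These fractions sum to less
  than \<open>1\<close>.\<close>

subsection \<open>Moments of symmetric Weibull variables\<close>

text \<open>Raise \<open>x \<le> exp x\<close> at \<open>x = y / (4 * s)\<close> to the power
  \<open>s\<close>. The explicit constant turns exponential moments into power moments and later
  makes powers of a logarithm negligible.\<close>

lemma powr_le_exp_quarter:
  fixes y s :: real
  assumes "0 \<le> y" and "0 < s"
  shows "y powr s \<le> (4 * s) powr s * exp (y / 4)"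
proof -
  have "y / (4 * s) \<le> exp (y / (4 * s))"
    using exp_ge_add_one_self[of "y / (4 * s)"] by linarith
  then have "(y / (4 * s)) powr s \<le> exp (y / (4 * s)) powr s"
    using assms by (intro powr_mono2) auto
  also have "\<dots> = exp (y / 4)"
    using assms by (simp add: powr_def)
  finally show ?thesis
    using assms by (simp add: powr_divide field_simps)
qed

lemma (in prob_space) integral_product_zero:
  fixes Y Z :: "'a \<Rightarrow> real"
  assumes "indep_var borel Y borel Z" and "integrable M Y" "integrable M Z"
    and "expectation Y = 0 \<or> expectation Z = 0"
  shows "expectation (\<lambda>\<omega>. Y \<omega> * Z \<omega>) = 0"
  using assms indep_var_lebesgue_integral[of Y Z] by auto

text \<open>Jensen's inequality for the \<open>q\<close>-th power given \<open>A\<close>: the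
  tangent at \<open>c\<close> lies below the power and is integrated over \<open>A\<close>. No
  conditional measure is formed, so \<open>prob A = 0\<close> is included.\<close>

lemma (in prob_space) moment_ge_on_event:
  fixes Z :: "'a \<Rightarrow> real"
  assumes q: "1 \<le> q" and c: "0 \<le> c" and A: "A \<in> events"
    and int: "integrable M Z" "integrable M (\<lambda>\<omega>. \<bar>Z \<omega>\<bar> powr q)"
    and mean: "c * prob A \<le> (\<integral>\<omega>. \<bar>Z \<omega>\<bar> * indicator A \<omega> \<partial>M)"
  shows "prob A * c powr q \<le> expectation (\<lambda>\<omega>. \<bar>Z \<omega>\<bar> powr q)"
proof (cases "c = 0")
  case True
  then show ?thesis using int by simp
next
  case False
  with c have c0: "0 < c" by simp
  have tangent: "c powr q + q * c powr (q - 1) * (\<bar>z\<bar> - c) \<le> \<bar>z\<bar> powr q" for z :: real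
  proof (cases "z = 0")
    case True
    \<comment> \<open>The point \<open>z = 0\<close> lies outside the open half-line used for
      convexity; there the claim reduces to \<open>1 \<le> q\<close>.\<close>
    have "c * c powr (q - 1) = c powr q"
      using c0 by (simp add: powr_diff)
    moreover have "c powr q \<le> q * c powr q"
      using mult_right_mono[OF q, of "c powr q"] by simp
    ultimately show ?thesis using True by (simp add: algebra_simps)
  next
    case False
    have "\<bar>z\<bar> powr q - c powr q \<ge> q * c powr (q - 1) * (\<bar>z\<bar> - c)"
      using c0 q False
      by (intro convex_on_imp_above_tangent[where A = "{0<..}"] powr_convex)
        (auto simp: interior_open intro!: has_field_derivative_at_within has_real_derivative_powr)
    then show ?thesis by simp
  qed
  note A[measurable]
  have iA: "integrable M (\<lambda>\<omega>. \<bar>Z \<omega>\<bar> * indicator A \<omega>)" "integrable M (indicat_real A)"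
    using int A by (auto intro!: integrable_real_mult_indicator simp: emeasure_eq_measure)
  have "prob A * c powr q \<le>
      c powr q * prob A + q * c powr (q - 1) * ((\<integral>\<omega>. \<bar>Z \<omega>\<bar> * indicator A \<omega> \<partial>M) - c * prob A)"
    using mean q by simp
  also have "\<dots> = (\<integral>\<omega>. c powr q * indicator A \<omega> +
      q * c powr (q - 1) * (\<bar>Z \<omega>\<bar> * indicator A \<omega> - c * indicator A \<omega>) \<partial>M)"
    using iA A by simp
  also have "\<dots> \<le> expectation (\<lambda>\<omega>. \<bar>Z \<omega>\<bar> powr q)"
  proof (rule integral_mono)
    fix \<omega>
    show "c powr q * indicator A \<omega> + q * c powr (q - 1) * (\<bar>Z \<omega>\<bar> * indicator A \<omega> - c * indicator A \<omega>)
        \<le> \<bar>Z \<omega>\<bar> powr q"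
      using tangent[of "Z \<omega>"] by (cases "\<omega> \<in> A") auto
  qed (use iA int in auto)
  finally show ?thesis .
qed

text \<open>\<open>\<bar>\<xi>\<bar> powr r\<close> is standard exponential, and multiplying its
  density by \<open>exp (s * x)\<close> gives \<open>1 / (1 - s)\<close> times the exponential
  density of rate \<open>1 - s\<close>.\<close>

lemma (in prob_space) symmetric_weibull_exp_moment:
  assumes r: "0 < r" and w: "symmetric_weibull M r \<xi>" and s: "s < 1"
  shows "integrable M (\<lambda>\<omega>. exp (s * \<bar>\<xi> \<omega>\<bar> powr r))"
    and "expectation (\<lambda>\<omega>. exp (s * \<bar>\<xi> \<omega>\<bar> powr r)) = 1 / (1 - s)"
proof -
  have m[measurable]: "\<xi> \<in> borel_measurable M"
    using w by (simp add: symmetric_weibull_def)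
  have "\<P>(\<omega> in M. \<bar>\<xi> \<omega>\<bar> powr r \<le> a) = 1 - exp (- a * 1)" if "0 \<le> a" for a
  proof -
    have "\<bar>\<xi> \<omega>\<bar> powr r \<le> a \<longleftrightarrow> \<not> \<bar>\<xi> \<omega>\<bar> > a powr (1/r)" for \<omega>
    proof -
      have "\<bar>\<xi> \<omega>\<bar> powr r \<le> (a powr (1/r)) powr r \<longleftrightarrow> \<bar>\<xi> \<omega>\<bar> \<le> a powr (1/r)"
        using r by (metis abs_ge_zero linorder_not_le powr_ge_zero powr_less_mono2 powr_mono2 less_imp_le)
      moreover have "(a powr (1/r)) powr r = a"
        using r that by (simp add: powr_powr)
      ultimately show ?thesis by auto
    qed
    then have "\<P>(\<omega> in M. \<bar>\<xi> \<omega>\<bar> powr r \<le> a) = 1 - \<P>(\<omega> in M. \<bar>\<xi> \<omega>\<bar> > a powr (1/r))"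
      using prob_neg[of "\<lambda>\<omega>. \<bar>\<xi> \<omega>\<bar> > a powr (1/r)"] by simp
    also have "\<P>(\<omega> in M. \<bar>\<xi> \<omega>\<bar> > a powr (1/r)) = exp (- ((a powr (1/r)) powr r))"
      using w by (simp add: symmetric_weibull_def)
    finally show ?thesis using r that by (simp add: powr_powr)
  qed
  then have D: "distributed M lborel (\<lambda>\<omega>. \<bar>\<xi> \<omega>\<bar> powr r) (exponential_density 1)"
    by (simp add: exponential_distributed_iff)
  interpret E: prob_space "density lborel (exponential_density (1 - s))"
    using s by (intro prob_space_exponential_density) simp
  have "(\<integral>\<^sup>+x. ennreal (exponential_density (1 - s) x) \<partial>lborel) = 1"
    using E.emeasure_space_1 by (simp add: emeasure_density)
  then have dens: "has_bochner_integral lborel (exponential_density (1 - s)) 1"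
    using s by (intro has_bochner_integral_nn_integral) (auto simp: exponential_density_nonneg)
  have eq: "exponential_density 1 x * exp (s * x) = exponential_density (1 - s) x / (1 - s)" for x :: real
    using s by (simp add: exponential_density_def exp_add[symmetric] algebra_simps eq_divide_eq)
  have I: "has_bochner_integral lborel (\<lambda>x. exponential_density 1 x * exp (s * x)) (1 / (1 - s))"
    unfolding eq using has_bochner_integral_divide_zero[OF dens, of "1 - s"] .
  show "integrable M (\<lambda>\<omega>. exp (s * \<bar>\<xi> \<omega>\<bar> powr r))"
    using distributed_integrable[OF D, of "\<lambda>x. exp (s * x)"] I
    by (auto simp: exponential_density_nonneg has_bochner_integral_iff)
  show "expectation (\<lambda>\<omega>. exp (s * \<bar>\<xi> \<omega>\<bar> powr r)) = 1 / (1 - s)"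
    using distributed_integral[OF D, of "\<lambda>x. exp (s * x)"] I
    by (auto simp: exponential_density_nonneg has_bochner_integral_iff)
qed

text \<open>Symmetry turns the integral into its own negative. This also covers a nonintegrable
  \<open>g \<circ> \<xi>\<close>, whose Bochner integral is \<open>0\<close>.\<close>

lemma symmetric_odd_integral:
  fixes \<xi> g :: "_ \<Rightarrow> real"
  assumes "symmetric_weibull M r \<xi>" and [measurable]: "g \<in> borel_measurable borel"
    and odd: "\<And>x. g (- x) = - g x"
  shows "(\<integral>\<omega>. g (\<xi> \<omega>) \<partial>M) = 0"
proof -
  have [measurable]: "\<xi> \<in> borel_measurable M"
    and "distr M borel \<xi> = distr M borel (\<lambda>\<omega>. - \<xi> \<omega>)"
    using assms by (auto simp: symmetric_weibull_def)
  then have "integral\<^sup>L (distr M borel \<xi>) g = integral\<^sup>L (distr M borel (\<lambda>\<omega>. - \<xi> \<omega>)) g"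
    by simp
  then have "(\<integral>\<omega>. g (\<xi> \<omega>) \<partial>M) = (\<integral>\<omega>. g (- \<xi> \<omega>) \<partial>M)"
    by (simp add: integral_distr)
  then show ?thesis by (simp add: odd)
qed

text \<open>As the power \<open>p / r\<close> of \<open>\<bar>\<xi>\<bar> powr r\<close>, the
  variable is dominated by a multiple of \<open>exp (1/4 * \<bar>\<xi>\<bar> powr r)\<close>, which
  has mean \<open>4 / 3\<close>.\<close>

lemma (in prob_space) symmetric_weibull_abs_moment:
  assumes r: "0 < r" and w: "symmetric_weibull M r \<xi>" and p: "0 < p"
  shows "integrable M (\<lambda>\<omega>. \<bar>\<xi> \<omega>\<bar> powr p)"
    and "expectation (\<lambda>\<omega>. \<bar>\<xi> \<omega>\<bar> powr p) \<le> 4 / 3 * (4 * (p / r)) powr (p / r)"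
proof -
  have m[measurable]: "\<xi> \<in> borel_measurable M"
    using w by (simp add: symmetric_weibull_def)
  let ?K = "(4 * (p / r)) powr (p / r)"
  have le: "\<bar>\<xi> \<omega>\<bar> powr p \<le> ?K * exp (1/4 * \<bar>\<xi> \<omega>\<bar> powr r)" for \<omega>
    using powr_le_exp_quarter[of "\<bar>\<xi> \<omega>\<bar> powr r" "p / r"] r p by (simp add: powr_powr)
  note E = symmetric_weibull_exp_moment[OF r w, of "1/4"]
  have I: "integrable M (\<lambda>\<omega>. ?K * exp (1/4 * \<bar>\<xi> \<omega>\<bar> powr r))"
    using E(1) by simp
  show int: "integrable M (\<lambda>\<omega>. \<bar>\<xi> \<omega>\<bar> powr p)"
    by (rule Bochner_Integration.integrable_bound[OF I]) (use le in \<open>auto intro!: AE_I2\<close>)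
  have "expectation (\<lambda>\<omega>. \<bar>\<xi> \<omega>\<bar> powr p) \<le> expectation (\<lambda>\<omega>. ?K * exp (1/4 * \<bar>\<xi> \<omega>\<bar> powr r))"
    using int I le by (rule integral_mono)
  also have "\<dots> = ?K * (1 / (1 - 1/4))"
    using E by simp
  finally show "expectation (\<lambda>\<omega>. \<bar>\<xi> \<omega>\<bar> powr p) \<le> 4 / 3 * ?K" by simp
qed

lemma (in prob_space) symmetric_weibull_integrable_power:
  assumes "0 < r" and w: "symmetric_weibull M r \<xi>"
  shows "integrable M (\<lambda>\<omega>. \<xi> \<omega> ^ k)"
\<comment> \<open>\<open>0 powr 0\<close> is \<open>0\<close> but \<open>0 ^ 0\<close> is
  \<open>1\<close>, so the exponent \<open>0\<close> is separate.\<close>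
proof (cases "k = 0")
  case False
  have m[measurable]: "\<xi> \<in> borel_measurable M"
    using w by (simp add: symmetric_weibull_def)
  have "\<bar>x ^ k\<bar> \<le> \<bar>x\<bar> powr k" for x :: real
    using False by (cases "x = 0") (auto simp: powr_realpow power_abs zero_power)
  then show ?thesis
    using False assms
    by (intro Bochner_Integration.integrable_bound[OF symmetric_weibull_abs_moment(1)[of r \<xi> "real k"]])
      (auto intro!: AE_I2)
qed simp

lemma (in prob_space) symmetric_weibull_second_moment_ge:
  assumes r: "0 < r" and w: "symmetric_weibull M r \<xi>"
  shows "exp (-1) \<le> expectation (\<lambda>\<omega>. (\<xi> \<omega>)\<^sup>2)"
proof -
  have m[measurable]: "\<xi> \<in> borel_measurable M"
    using w by (simp add: symmetric_weibull_def)
  have "exp (-1) = prob {\<omega> \<in> space M. \<bar>\<xi> \<omega>\<bar> > 1}"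
    using w by (auto simp: symmetric_weibull_def)
  also have "\<dots> = expectation (indicator {\<omega> \<in> space M. \<bar>\<xi> \<omega>\<bar> > 1})"
    by simp
  also have "\<dots> \<le> expectation (\<lambda>\<omega>. (\<xi> \<omega>)\<^sup>2)"
  proof (rule integral_mono)
    show "integrable M (\<lambda>\<omega>. (\<xi> \<omega>)\<^sup>2)"
      by (rule symmetric_weibull_integrable_power[OF r w])
  qed (auto simp: indicator_def emeasure_eq_measure abs_square_le_1[symmetric] not_le
        intro!: less_imp_le dest: power_strict_mono[of 1 "\<bar>_\<bar>" 2])
  finally show ?thesis .
qed

subsection \<open>Linear combinations of independent symmetric Weibull variables\<close>

locale weibull_family = prob_space M for M :: "'a measure" +
  fixes r :: real and N :: nat and X :: "nat \<Rightarrow> 'a \<Rightarrow> real"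
  assumes r_pos: "0 < r"
    and indep: "indep_vars (\<lambda>_. borel) X {..<N}"
    and weibull: "i < N \<Longrightarrow> symmetric_weibull M r (X i)"
begin

lemma measurable_X [measurable]: "i < N \<Longrightarrow> X i \<in> borel_measurable M"
  using weibull by (simp add: symmetric_weibull_def)

lemma measurable_lin_comb [measurable]: "n \<le> N \<Longrightarrow> lin_comb n X y \<in> borel_measurable M"
  unfolding lin_comb_def[abs_def] by (intro borel_measurable_sum borel_measurable_times) auto

text \<open>Every \<open>\<bar>X i \<omega>\<bar>\<close> is replaced by the largest one, whose
  power is at most the sum of all powers. This crude bound only serves integrability.\<close>

lemma abs_lin_comb_le:
  assumes "0 < p"
  shows "\<bar>lin_comb n X y \<omega>\<bar> powr p \<le> (\<Sum>i<n. \<bar>y i\<bar>) powr p * (\<Sum>i<n. \<bar>X i \<omega>\<bar> powr p)"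
proof (cases "n = 0")
  case True
  then show ?thesis by (simp add: lin_comb_def)
next
  case False
  obtain k where k: "k < n" "\<And>i. i < n \<Longrightarrow> \<bar>X i \<omega>\<bar> \<le> \<bar>X k \<omega>\<bar>"
  proof -
    have "Max ((\<lambda>i. \<bar>X i \<omega>\<bar>) ` {..<n}) \<in> (\<lambda>i. \<bar>X i \<omega>\<bar>) ` {..<n}"
      using False by (intro Max_in) (auto simp: lessThan_empty_iff)
    then obtain k where "k < n" "Max ((\<lambda>i. \<bar>X i \<omega>\<bar>) ` {..<n}) = \<bar>X k \<omega>\<bar>" by auto
    moreover have "\<bar>X i \<omega>\<bar> \<le> Max ((\<lambda>i. \<bar>X i \<omega>\<bar>) ` {..<n})" if "i < n" for i
      using that by (intro Max_ge) auto
    ultimately show ?thesis using that by auto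
  qed
  have "\<bar>lin_comb n X y \<omega>\<bar> \<le> (\<Sum>i<n. \<bar>y i\<bar> * \<bar>X i \<omega>\<bar>)"
    unfolding lin_comb_def by (rule order_trans[OF sum_abs]) (simp add: abs_mult)
  also have "\<dots> \<le> (\<Sum>i<n. \<bar>y i\<bar> * \<bar>X k \<omega>\<bar>)"
    by (intro sum_mono mult_left_mono) (auto simp: k(2))
  also have "\<dots> = (\<Sum>i<n. \<bar>y i\<bar>) * \<bar>X k \<omega>\<bar>"
    by (simp add: sum_distrib_right)
  finally have "\<bar>lin_comb n X y \<omega>\<bar> powr p \<le> ((\<Sum>i<n. \<bar>y i\<bar>) * \<bar>X k \<omega>\<bar>) powr p"
    using assms by (intro powr_mono2) auto
  also have "\<dots> = (\<Sum>i<n. \<bar>y i\<bar>) powr p * \<bar>X k \<omega>\<bar> powr p"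
    by (simp add: powr_mult sum_nonneg)
  also have "\<dots> \<le> (\<Sum>i<n. \<bar>y i\<bar>) powr p * (\<Sum>i<n. \<bar>X i \<omega>\<bar> powr p)"
    using k(1) by (intro mult_left_mono member_le_sum[of k _ "\<lambda>i. \<bar>X i \<omega>\<bar> powr p"]) auto
  finally show ?thesis .
qed

lemma integrable_lin_comb_powr:
  assumes "n \<le> N" and "0 < p"
  shows "integrable M (\<lambda>\<omega>. \<bar>lin_comb n X y \<omega>\<bar> powr p)"
proof -
  have "integrable M (\<lambda>\<omega>. (\<Sum>i<n. \<bar>y i\<bar>) powr p * (\<Sum>i<n. \<bar>X i \<omega>\<bar> powr p))"
    using assms by (intro integrable_mult_right Bochner_Integration.integrable_sum
        symmetric_weibull_abs_moment(1)[OF r_pos weibull]) auto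
  then show ?thesis
    by (rule Bochner_Integration.integrable_bound)
      (use assms abs_lin_comb_le[OF assms(2)] in \<open>auto intro!: AE_I2 order_trans[OF _ abs_ge_self]\<close>)
qed

lemma integrable_lin_comb_power:
  assumes "n \<le> N"
  shows "integrable M (\<lambda>\<omega>. lin_comb n X y \<omega> ^ k)"
proof (cases "k = 0")
  case False
  have "\<bar>x ^ k\<bar> \<le> \<bar>x\<bar> powr k" for x :: real
    using False by (cases "x = 0") (auto simp: powr_realpow power_abs zero_power)
  then show ?thesis
    using False assms
    by (intro Bochner_Integration.integrable_bound[OF integrable_lin_comb_powr[of n "real k" y]])
      (auto intro!: AE_I2)
qed simp

lemma integrable_lin_comb: "n \<le> N \<Longrightarrow> integrable M (lin_comb n X y)"
  using integrable_lin_comb_power[of n y 1] by simp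

lemma integrable_X_power: "i < N \<Longrightarrow> integrable M (\<lambda>\<omega>. X i \<omega> ^ k)"
  using symmetric_weibull_integrable_power[OF r_pos weibull] .

lemma integrable_X: "i < N \<Longrightarrow> integrable M (X i)"
  using integrable_X_power[of i 1] by simp

lemma odd_moment_X: "i < N \<Longrightarrow> odd k \<Longrightarrow> expectation (\<lambda>\<omega>. X i \<omega> ^ k) = 0"
  using symmetric_odd_integral[OF weibull, of i "\<lambda>x. x ^ k"] by simp

lemma expectation_X: "i < N \<Longrightarrow> expectation (X i) = 0"
  using odd_moment_X[of i 1] by simp

lemma indep_coordinate_sum:
  assumes "i < N" and "I \<subseteq> {..<N}" and "i \<notin> I"
  shows "indep_var borel (X i) borel (\<lambda>\<omega>. \<Sum>j\<in>I. y j * X j \<omega>)"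
proof -
  have fin: "finite I" using assms finite_subset by blast
  have "indep_vars (\<lambda>_. borel) X (insert i I)"
    using assms by (intro indep_vars_subset[OF indep]) auto
  then have "indep_vars (\<lambda>_. borel) (\<lambda>j \<omega>. (if j = i then 1 else y j) * X j \<omega>) (insert i I)"
    by (rule indep_vars_compose2) simp
  from indep_vars_sum[OF fin assms(3) this]
  have "indep_var borel (\<lambda>\<omega>. 1 * X i \<omega>) borel (\<lambda>\<omega>. \<Sum>j\<in>I. (if j = i then 1 else y j) * X j \<omega>)"
    by simp
  also have "(\<lambda>\<omega>. \<Sum>j\<in>I. (if j = i then 1 else y j) * X j \<omega>) = (\<lambda>\<omega>. \<Sum>j\<in>I. y j * X j \<omega>)"
    using assms by (intro ext sum.cong) auto
  finally show ?thesis by simp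
qed

lemma lin_comb_Suc: "lin_comb (Suc n) X y \<omega> = lin_comb n X y \<omega> + y n * X n \<omega>"
  by (simp add: lin_comb_def)

text \<open>\<open>X n\<close> is independent of the combination of the coordinates below
  \<open>n\<close>, so powers of a combination can be expanded one coordinate at a time.\<close>

lemma
  assumes n: "n < N"
  shows mixed_moment: "expectation (\<lambda>\<omega>. X n \<omega> ^ a * lin_comb n X y \<omega> ^ b) =
      expectation (\<lambda>\<omega>. X n \<omega> ^ a) * expectation (\<lambda>\<omega>. lin_comb n X y \<omega> ^ b)"
    and integrable_mixed: "integrable M (\<lambda>\<omega>. X n \<omega> ^ a * lin_comb n X y \<omega> ^ b)"
proof -
  have "indep_var borel (X n) borel (lin_comb n X y)"
    unfolding lin_comb_def[abs_def] using n by (intro indep_coordinate_sum) auto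
  then have "indep_var borel ((\<lambda>x. x ^ a) \<circ> X n) borel ((\<lambda>x. x ^ b) \<circ> lin_comb n X y)"
    by (rule indep_var_compose) auto
  then have ind: "indep_var borel (\<lambda>\<omega>. X n \<omega> ^ a) borel (\<lambda>\<omega>. lin_comb n X y \<omega> ^ b)"
    by (simp add: comp_def)
  note int = integrable_X_power[OF n, of a] integrable_lin_comb_power[of n y b]
  show "expectation (\<lambda>\<omega>. X n \<omega> ^ a * lin_comb n X y \<omega> ^ b) =
      expectation (\<lambda>\<omega>. X n \<omega> ^ a) * expectation (\<lambda>\<omega>. lin_comb n X y \<omega> ^ b)"
    using n int by (intro indep_var_lebesgue_integral[OF ind]) auto
  show "integrable M (\<lambda>\<omega>. X n \<omega> ^ a * lin_comb n X y \<omega> ^ b)"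
    using n int by (intro indep_var_integrable[OF ind]) auto
qed

lemma second_moment_Suc:
  assumes n: "n < N"
  shows "expectation (\<lambda>\<omega>. (lin_comb (Suc n) X y \<omega>)\<^sup>2) =
    expectation (\<lambda>\<omega>. (lin_comb n X y \<omega>)\<^sup>2) + (y n)\<^sup>2 * expectation (\<lambda>\<omega>. (X n \<omega>)\<^sup>2)"
proof -
  let ?Z = "lin_comb n X y"
  have eq: "(lin_comb (Suc n) X y \<omega>)\<^sup>2 =
      (?Z \<omega>)\<^sup>2 + (2 * y n) * (X n \<omega> ^ 1 * ?Z \<omega> ^ 1) + (y n)\<^sup>2 * (X n \<omega>)\<^sup>2" for \<omega>
    by (simp add: lin_comb_Suc power2_eq_square algebra_simps)
  have "expectation (\<lambda>\<omega>. (lin_comb (Suc n) X y \<omega>)\<^sup>2) = expectation (\<lambda>\<omega>. (?Z \<omega>)\<^sup>2)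
     + (2 * y n) * expectation (\<lambda>\<omega>. X n \<omega> ^ 1 * ?Z \<omega> ^ 1) + (y n)\<^sup>2 * expectation (\<lambda>\<omega>. (X n \<omega>)\<^sup>2)"
    unfolding eq using n integrable_mixed[OF n, of 1 y 1] integrable_lin_comb_power[of n y 2]
      integrable_X_power[OF n, of 2] by simp
  also have "expectation (\<lambda>\<omega>. X n \<omega> ^ 1 * ?Z \<omega> ^ 1) = 0"
    using n expectation_X[OF n] by (subst mixed_moment) auto
  finally show ?thesis by simp
qed

text \<open>The terms with an odd power of \<open>X n\<close> in the binomial expansion have mean
  \<open>0\<close> by symmetry.\<close>

lemma fourth_moment_Suc:
  assumes n: "n < N"
  shows "expectation (\<lambda>\<omega>. lin_comb (Suc n) X y \<omega> ^ 4) =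
    expectation (\<lambda>\<omega>. lin_comb n X y \<omega> ^ 4)
    + 6 * (y n)\<^sup>2 * (expectation (\<lambda>\<omega>. (X n \<omega>)\<^sup>2) * expectation (\<lambda>\<omega>. (lin_comb n X y \<omega>)\<^sup>2))
    + y n ^ 4 * expectation (\<lambda>\<omega>. X n \<omega> ^ 4)"
proof -
  let ?Z = "lin_comb n X y"
  have eq: "lin_comb (Suc n) X y \<omega> ^ 4 = ?Z \<omega> ^ 4 + (4 * y n) * (X n \<omega> ^ 1 * ?Z \<omega> ^ 3)
      + (6 * (y n)\<^sup>2) * (X n \<omega> ^ 2 * ?Z \<omega> ^ 2) + (4 * y n ^ 3) * (X n \<omega> ^ 3 * ?Z \<omega> ^ 1)
      + y n ^ 4 * X n \<omega> ^ 4" for \<omega>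
    unfolding lin_comb_Suc by algebra
  have "expectation (\<lambda>\<omega>. lin_comb (Suc n) X y \<omega> ^ 4) = expectation (\<lambda>\<omega>. ?Z \<omega> ^ 4)
     + (4 * y n) * expectation (\<lambda>\<omega>. X n \<omega> ^ 1 * ?Z \<omega> ^ 3)
     + (6 * (y n)\<^sup>2) * expectation (\<lambda>\<omega>. X n \<omega> ^ 2 * ?Z \<omega> ^ 2)
     + (4 * y n ^ 3) * expectation (\<lambda>\<omega>. X n \<omega> ^ 3 * ?Z \<omega> ^ 1)
     + y n ^ 4 * expectation (\<lambda>\<omega>. X n \<omega> ^ 4)"
    unfolding eq using n integrable_mixed[OF n, of 1 y 3] integrable_mixed[OF n, of 2 y 2]
      integrable_mixed[OF n, of 3 y 1] integrable_lin_comb_power[of n y 4]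
      integrable_X_power[OF n, of 4] by simp
  also have "expectation (\<lambda>\<omega>. X n \<omega> ^ 1 * ?Z \<omega> ^ 3) = 0"
    using n expectation_X[OF n] by (subst mixed_moment) auto
  also have "expectation (\<lambda>\<omega>. X n \<omega> ^ 3 * ?Z \<omega> ^ 1) = 0"
    using n odd_moment_X[OF n, of 3] by (subst mixed_moment) auto
  also have "expectation (\<lambda>\<omega>. X n \<omega> ^ 2 * ?Z \<omega> ^ 2) =
      expectation (\<lambda>\<omega>. (X n \<omega>)\<^sup>2) * expectation (\<lambda>\<omega>. (?Z \<omega>)\<^sup>2)"
    by (rule mixed_moment[OF n])
  finally show ?thesis by simp
qed

lemma second_moment_le:
  assumes w: "\<And>i. i < N \<Longrightarrow> expectation (\<lambda>\<omega>. (X i \<omega>)\<^sup>2) \<le> w" and "n \<le> N"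
  shows "expectation (\<lambda>\<omega>. (lin_comb n X y \<omega>)\<^sup>2) \<le> w * (\<Sum>i<n. (y i)\<^sup>2)"
  using \<open>n \<le> N\<close>
proof (induction n)
  case 0
  then show ?case by (simp add: lin_comb_def)
next
  case (Suc n)
  then show ?case
    using second_moment_Suc[of n y] w[of n] mult_left_mono[OF w, of n "(y n)\<^sup>2"]
    by (simp add: algebra_simps)
qed

lemma second_moment_ge:
  assumes v: "\<And>i. i < N \<Longrightarrow> v \<le> expectation (\<lambda>\<omega>. (X i \<omega>)\<^sup>2)" and "n \<le> N"
  shows "v * (\<Sum>i<n. (y i)\<^sup>2) \<le> expectation (\<lambda>\<omega>. (lin_comb n X y \<omega>)\<^sup>2)"
  using \<open>n \<le> N\<close>
proof (induction n)
  case 0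
  then show ?case by (simp add: lin_comb_def)
next
  case (Suc n)
  then show ?case
    using second_moment_Suc[of n y] v[of n] mult_left_mono[OF v, of n "(y n)\<^sup>2"]
    by (simp add: algebra_simps)
qed

text \<open>With \<open>S\<close> the sum of the earlier squares, the induction closes because the
  mixed term, at most \<open>6 * (y n)\<^sup>2 * w\<^sup>2 * S\<close>, is below the cross term
  \<open>2 * B * (y n)\<^sup>2 * S\<close> of \<open>B * (S + (y n)\<^sup>2)\<^sup>2\<close>. This
  is the condition \<open>3 * w\<^sup>2 \<le> B\<close>.\<close>

lemma fourth_moment_le:
  assumes w: "\<And>i. i < N \<Longrightarrow> expectation (\<lambda>\<omega>. (X i \<omega>)\<^sup>2) \<le> w"
    and k: "\<And>i. i < N \<Longrightarrow> expectation (\<lambda>\<omega>. X i \<omega> ^ 4) \<le> B"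
    and B: "3 * w\<^sup>2 \<le> B" and "n \<le> N"
  shows "expectation (\<lambda>\<omega>. lin_comb n X y \<omega> ^ 4) \<le> B * (\<Sum>i<n. (y i)\<^sup>2)\<^sup>2"
  using \<open>n \<le> N\<close>
proof (induction n)
  case 0
  then show ?case by (simp add: lin_comb_def)
next
  case (Suc n)
  define S where "S = (\<Sum>i<n. (y i)\<^sup>2)"
  have S: "0 \<le> S" unfolding S_def by (intro sum_nonneg) auto
  have pos: "0 \<le> expectation (\<lambda>\<omega>. (X n \<omega>)\<^sup>2)" "0 \<le> expectation (\<lambda>\<omega>. (lin_comb n X y \<omega>)\<^sup>2)"
    by (auto intro: integral_nonneg)
  have w0: "0 \<le> w" using pos(1) w[of n] Suc.prems by linarith
  have "expectation (\<lambda>\<omega>. (X n \<omega>)\<^sup>2) * expectation (\<lambda>\<omega>. (lin_comb n X y \<omega>)\<^sup>2) \<le> w * (w * S)"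
    using pos w[of n] second_moment_le[OF w, of n y] Suc.prems w0 unfolding S_def
    by (intro mult_mono) auto
  then have "6 * (y n)\<^sup>2 * (expectation (\<lambda>\<omega>. (X n \<omega>)\<^sup>2) * expectation (\<lambda>\<omega>. (lin_comb n X y \<omega>)\<^sup>2))
      \<le> 6 * (y n)\<^sup>2 * (w * (w * S))"
    by (intro mult_left_mono) auto
  also have "\<dots> = 2 * (y n)\<^sup>2 * S * (3 * w\<^sup>2)" by (simp add: power2_eq_square)
  also have "\<dots> \<le> 2 * (y n)\<^sup>2 * S * B" using S B by (intro mult_left_mono) auto
  finally have 1: "6 * (y n)\<^sup>2 * (expectation (\<lambda>\<omega>. (X n \<omega>)\<^sup>2) *
      expectation (\<lambda>\<omega>. (lin_comb n X y \<omega>)\<^sup>2)) \<le> 2 * (y n)\<^sup>2 * S * B" .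
  have 2: "y n ^ 4 * expectation (\<lambda>\<omega>. X n \<omega> ^ 4) \<le> y n ^ 4 * B"
    using k[of n] Suc.prems by (intro mult_left_mono) auto
  have "expectation (\<lambda>\<omega>. lin_comb (Suc n) X y \<omega> ^ 4) \<le> B * S\<^sup>2 + 2 * (y n)\<^sup>2 * S * B + y n ^ 4 * B"
    using Suc.IH Suc.prems 1 2 fourth_moment_Suc[of n y] unfolding S_def by linarith
  also have "\<dots> = B * (S + (y n)\<^sup>2)\<^sup>2" by algebra
  finally show ?case by (simp add: S_def)
qed

text \<open>A small first moment would force a large fourth moment:
  \<open>z\<^sup>2 \<le> a \<bar>z\<bar> + z\<^sup>4 / a\<^sup>2\<close> for every \<open>a > 0\<close>.\<close>

lemma first_moment_ge:
  assumes v: "\<And>i. i < N \<Longrightarrow> v \<le> expectation (\<lambda>\<omega>. (X i \<omega>)\<^sup>2)" "0 < v"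
    and w: "\<And>i. i < N \<Longrightarrow> expectation (\<lambda>\<omega>. (X i \<omega>)\<^sup>2) \<le> w"
    and k: "\<And>i. i < N \<Longrightarrow> expectation (\<lambda>\<omega>. X i \<omega> ^ 4) \<le> B"
    and B: "3 * w\<^sup>2 \<le> B" "0 < B"
  shows "v ^ 3 * (\<Sum>i<N. (y i)\<^sup>2) \<le> 8 * B * (expectation (\<lambda>\<omega>. \<bar>lin_comb N X y \<omega>\<bar>))\<^sup>2"
proof -
  define S where "S = (\<Sum>i<N. (y i)\<^sup>2)"
  have S: "0 \<le> S" unfolding S_def by (intro sum_nonneg) auto
  show ?thesis
  proof (cases "S = 0")
    case True
    then show ?thesis using B by (simp add: S_def[symmetric])
  next
    case False
    with S have S0: "0 < S" by simp
    \<comment> \<open>This \<open>a\<close> makes \<open>B * S\<^sup>2 / a\<^sup>2\<close> half of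
      the lower bound \<open>v * S\<close> for the second moment.\<close>
    define a where "a = sqrt (2 * B * S / v)"
    have a: "0 < a" "a\<^sup>2 = 2 * B * S / v" using S0 v B by (auto simp: a_def)
    let ?Z = "lin_comb N X y"
    have pw: "z\<^sup>2 \<le> a * \<bar>z\<bar> + z ^ 4 / a\<^sup>2" for z :: real
    proof (cases "\<bar>z\<bar> \<le> a")
      case True
      then have "\<bar>z\<bar> * \<bar>z\<bar> \<le> a * \<bar>z\<bar>" by (intro mult_right_mono) auto
      moreover have "0 \<le> z ^ 4 / a\<^sup>2" by (intro divide_nonneg_nonneg) auto
      moreover have "z\<^sup>2 = \<bar>z\<bar> * \<bar>z\<bar>" by (simp add: power2_eq_square)
      ultimately show ?thesis by linarith
    next
      case False
      then have "a\<^sup>2 \<le> z\<^sup>2" using a by (metis abs_le_square_iff abs_of_pos less_imp_le not_le)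
      then have "a\<^sup>2 * z\<^sup>2 \<le> z\<^sup>2 * z\<^sup>2" by (intro mult_right_mono) auto
      then have "z\<^sup>2 \<le> z ^ 4 / a\<^sup>2" using a(1) by (simp add: field_simps power4_eq_xxxx power2_eq_square)
      moreover have "0 \<le> a * \<bar>z\<bar>" using a by simp
      ultimately show ?thesis by linarith
    qed
    have "v * S \<le> expectation (\<lambda>\<omega>. (?Z \<omega>)\<^sup>2)"
      unfolding S_def by (rule second_moment_ge[OF v(1)]) auto
    also have "\<dots> \<le> expectation (\<lambda>\<omega>. a * \<bar>?Z \<omega>\<bar> + ?Z \<omega> ^ 4 / a\<^sup>2)"
      using integrable_lin_comb integrable_lin_comb_power
      by (intro integral_mono) (auto simp: pw)
    also have "\<dots> = a * expectation (\<lambda>\<omega>. \<bar>?Z \<omega>\<bar>) + expectation (\<lambda>\<omega>. ?Z \<omega> ^ 4) / a\<^sup>2"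
      using integrable_lin_comb integrable_lin_comb_power by simp
    also have "\<dots> \<le> a * expectation (\<lambda>\<omega>. \<bar>?Z \<omega>\<bar>) + B * S\<^sup>2 / a\<^sup>2"
      using fourth_moment_le[OF w k B(1), of N y] unfolding S_def
      by (intro add_left_mono divide_right_mono) auto
    also have "B * S\<^sup>2 / a\<^sup>2 = v * S / 2"
      using a S0 B v by (simp add: power2_eq_square)
    finally have "v * S / 2 \<le> a * expectation (\<lambda>\<omega>. \<bar>?Z \<omega>\<bar>)" by simp
    then have "(v * S / 2)\<^sup>2 \<le> (a * expectation (\<lambda>\<omega>. \<bar>?Z \<omega>\<bar>))\<^sup>2"
      using S0 v by (intro power_mono) auto
    then have "v\<^sup>2 * S\<^sup>2 / 4 \<le> 2 * B * S / v * (expectation (\<lambda>\<omega>. \<bar>?Z \<omega>\<bar>))\<^sup>2"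
      by (simp add: power_mult_distrib power_divide a(2))
    then have "S * (v ^ 3 * S) \<le> S * (8 * B * (expectation (\<lambda>\<omega>. \<bar>?Z \<omega>\<bar>))\<^sup>2)"
      using v S0 by (simp add: field_simps power2_eq_square power3_eq_cube)
    then show ?thesis using S0 by (simp add: S_def[symmetric])
  qed
qed

lemma expectation_abs_le_Lp_norm:
  assumes q: "1 \<le> q"
  shows "expectation (\<lambda>\<omega>. \<bar>lin_comb N X y \<omega>\<bar>) \<le> Lp_norm M q (lin_comb N X y)"
proof -
  let ?m = "expectation (\<lambda>\<omega>. \<bar>lin_comb N X y \<omega>\<bar>)"
  have m: "0 \<le> ?m" by simp
  have "(\<integral>\<omega>. \<bar>lin_comb N X y \<omega>\<bar> * indicator (space M) \<omega> \<partial>M) = ?m"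
    by (intro Bochner_Integration.integral_cong) auto
  then have "prob (space M) * ?m powr q \<le> expectation (\<lambda>\<omega>. \<bar>lin_comb N X y \<omega>\<bar> powr q)"
    using q m by (intro moment_ge_on_event integrable_lin_comb integrable_lin_comb_powr)
      (auto simp: prob_space)
  then have "(?m powr q) powr (1 / q) \<le> Lp_norm M q (lin_comb N X y)"
    unfolding Lp_norm_def using q by (intro powr_mono2) (auto simp: prob_space)
  then show ?thesis using m q by (simp add: powr_powr)
qed

text \<open>\<open>\<bar>X i\<bar>\<close> exceeds \<open>q powr (1 / r)\<close> with probability
  \<open>exp (- q)\<close>, whose \<open>q\<close>-th root costs only the factor
  \<open>exp 1\<close>. On this event the independent, centred rest of the sum cannot push the mean
  of \<open>\<bar>lin_comb N X y\<bar>\<close> below what coordinate \<open>i\<close> alone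
  gives.\<close>

lemma coordinate_le_Lp_norm:
  assumes q: "1 \<le> q" and i: "i < N"
  shows "\<bar>y i\<bar> * q powr (1 / r) \<le> exp 1 * Lp_norm M q (lin_comb N X y)"
proof -
  let ?Z = "lin_comb N X y" and ?u = "q powr (1 / r)"
  define A where "A = {\<omega> \<in> space M. \<bar>X i \<omega>\<bar> > ?u}"
  \<comment> \<open>Testing \<open>Z\<close> against an odd function of \<open>X i\<close> supported on \<open>A\<close> removes the other coordinates.\<close>
  define h :: "real \<Rightarrow> real" where "h x = (if \<bar>x\<bar> > ?u then sgn x else 0)" for x
  define W where "W \<omega> = (\<Sum>j\<in>{..<N} - {i}. y j * X j \<omega>)" for \<omega>
  have hm[measurable]: "h \<in> borel_measurable borel" unfolding h_def[abs_def] by measurable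
  have Xm[measurable]: "X i \<in> borel_measurable M" using i by simp
  have A[measurable]: "A \<in> events" unfolding A_def by measurable
  have pA: "prob A = exp (- q)"
    using weibull[OF i] q r_pos by (simp add: symmetric_weibull_def A_def powr_powr)
  have Zeq: "?Z \<omega> = y i * X i \<omega> + W \<omega>" for \<omega>
    using i by (simp add: lin_comb_def W_def sum.remove)
  have iW: "integrable M W"
    unfolding W_def by (intro Bochner_Integration.integrable_sum integrable_mult_right integrable_X) auto
  have ih: "integrable M (\<lambda>\<omega>. h (X i \<omega>))"
    by (intro integrable_const_bound[where B = 1]) (auto simp: h_def sgn_real_def)
  have ixh: "integrable M (\<lambda>\<omega>. X i \<omega> * h (X i \<omega>))"
    by (rule Bochner_Integration.integrable_bound[OF integrable_X[OF i]])
      (auto simp: h_def sgn_real_def)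
  have "indep_var borel (X i) borel W"
    unfolding W_def using i by (intro indep_coordinate_sum) auto
  then have "indep_var borel (h \<circ> X i) borel ((\<lambda>x. x) \<circ> W)"
    by (rule indep_var_compose) auto
  then have ind: "indep_var borel (\<lambda>\<omega>. h (X i \<omega>)) borel W" by (simp add: comp_def)
  have "expectation (\<lambda>\<omega>. h (X i \<omega>)) = 0"
    by (rule symmetric_odd_integral[OF weibull[OF i]]) (auto simp: h_def sgn_real_def)
  then have hW: "expectation (\<lambda>\<omega>. h (X i \<omega>) * W \<omega>) = 0"
    using integral_product_zero[OF ind ih iW] by simp
  have ihW: "integrable M (\<lambda>\<omega>. h (X i \<omega>) * W \<omega>)"
    using indep_var_integrable[OF ind ih iW] .
  have ZA: "\<bar>?Z \<omega>\<bar> * indicator A \<omega> \<ge> sgn (y i) * (y i * (X i \<omega> * h (X i \<omega>)) + h (X i \<omega>) * W \<omega>)"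
    if "\<omega> \<in> space M" for \<omega>
  proof -
    have "sgn (y i) * (y i * (X i \<omega> * h (X i \<omega>)) + h (X i \<omega>) * W \<omega>) = (sgn (y i) * h (X i \<omega>)) * ?Z \<omega>"
      by (simp add: Zeq algebra_simps)
    also have "\<dots> \<le> \<bar>?Z \<omega>\<bar> * indicator A \<omega>"
      using that by (auto simp: h_def A_def sgn_real_def indicator_def)
    finally show ?thesis .
  qed
  have "\<bar>y i\<bar> * ?u * prob A = \<bar>y i\<bar> * (\<integral>\<omega>. ?u * indicator A \<omega> \<partial>M)"
    using A by simp
  also have "\<dots> \<le> \<bar>y i\<bar> * expectation (\<lambda>\<omega>. X i \<omega> * h (X i \<omega>))"
  proof (intro mult_left_mono integral_mono)
    show "integrable M (\<lambda>\<omega>. ?u * indicat_real A \<omega>)"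
      using A by (intro integrable_mult_right) (simp add: emeasure_eq_measure)
  qed (use ixh in \<open>auto simp: A_def h_def indicator_def sgn_real_def\<close>)
  also have "\<dots> = (\<integral>\<omega>. sgn (y i) * (y i * (X i \<omega> * h (X i \<omega>)) + h (X i \<omega>) * W \<omega>) \<partial>M)"
  proof -
    have "(\<integral>\<omega>. sgn (y i) * (y i * (X i \<omega> * h (X i \<omega>)) + h (X i \<omega>) * W \<omega>) \<partial>M) =
        sgn (y i) * (y i * expectation (\<lambda>\<omega>. X i \<omega> * h (X i \<omega>)))"
      using ixh ihW hW by simp
    then show ?thesis by (simp only: abs_sgn mult.commute mult.left_commute)
  qed
  also have "\<dots> \<le> (\<integral>\<omega>. \<bar>?Z \<omega>\<bar> * indicator A \<omega> \<partial>M)"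
    using ZA ixh ihW integrable_lin_comb[of N y] A
    by (intro integral_mono) (auto intro!: integrable_real_mult_indicator)
  finally have "prob A * (\<bar>y i\<bar> * ?u) powr q \<le> expectation (\<lambda>\<omega>. \<bar>?Z \<omega>\<bar> powr q)"
    using q A by (intro moment_ge_on_event integrable_lin_comb integrable_lin_comb_powr) auto
  then have "(exp (- q) * (\<bar>y i\<bar> * ?u) powr q) powr (1 / q) \<le> Lp_norm M q ?Z"
    unfolding Lp_norm_def pA using q by (intro powr_mono2) auto
  moreover have "(exp (- q) * (\<bar>y i\<bar> * ?u) powr q) powr (1 / q) = exp (- 1) * (\<bar>y i\<bar> * ?u)"
  proof -
    have "exp (- q) powr (1 / q) = exp (-1)" using q by (simp add: powr_def)
    then show ?thesis using q by (simp add: powr_mult powr_powr)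
  qed
  ultimately have "exp (- 1) * (\<bar>y i\<bar> * ?u) \<le> Lp_norm M q ?Z" by (simp only:)
  then show ?thesis by (simp add: exp_minus field_simps)
qed

lemma exp_moment_sum:
  assumes "S \<subseteq> {..<N}"
  shows "integrable M (\<lambda>\<omega>. exp (1/2 * (\<Sum>i\<in>S. \<bar>X i \<omega>\<bar> powr r)))"
    and "expectation (\<lambda>\<omega>. exp (1/2 * (\<Sum>i\<in>S. \<bar>X i \<omega>\<bar> powr r))) = 2 ^ card S"
proof -
  have fin: "finite S" using assms finite_subset by blast
  have eq: "exp (1/2 * (\<Sum>i\<in>S. \<bar>X i \<omega>\<bar> powr r)) = (\<Prod>i\<in>S. exp (1/2 * \<bar>X i \<omega>\<bar> powr r))" for \<omega>
    by (simp add: sum_distrib_left exp_sum fin)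
  have ind: "indep_vars (\<lambda>_. borel) (\<lambda>i \<omega>. exp (1/2 * \<bar>X i \<omega>\<bar> powr r)) S"
    by (rule indep_vars_compose2[OF indep_vars_subset[OF indep assms]]) auto
  have E: "integrable M (\<lambda>\<omega>. exp (1/2 * \<bar>X i \<omega>\<bar> powr r))"
      "expectation (\<lambda>\<omega>. exp (1/2 * \<bar>X i \<omega>\<bar> powr r)) = 2" if "i \<in> S" for i
    using symmetric_weibull_exp_moment[OF r_pos weibull, of i "1/2"] that assms by auto
  show "integrable M (\<lambda>\<omega>. exp (1/2 * (\<Sum>i\<in>S. \<bar>X i \<omega>\<bar> powr r)))"
    unfolding eq by (rule indep_vars_integrable[OF fin ind E(1)])
  have "expectation (\<lambda>\<omega>. \<Prod>i\<in>S. exp (1/2 * \<bar>X i \<omega>\<bar> powr r)) =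
      (\<Prod>i\<in>S. expectation (\<lambda>\<omega>. exp (1/2 * \<bar>X i \<omega>\<bar> powr r)))"
    by (rule indep_vars_lebesgue_integral[OF fin ind E(1)])
  also have "\<dots> = (\<Prod>i\<in>S. 2)" by (rule prod.cong[OF refl E(2)])
  also have "\<dots> = 2 ^ card S" by simp
  finally show "expectation (\<lambda>\<omega>. exp (1/2 * (\<Sum>i\<in>S. \<bar>X i \<omega>\<bar> powr r))) = 2 ^ card S"
    unfolding eq .
qed

text \<open>Values with \<open>\<bar>x\<bar>\<^sup>r \<le> 2 ln N\<close> are charged to an exponential moment of \<open>\<bar>x\<bar>\<^sup>r\<close>; larger ones
  are so rare that their total over all \<open>N\<close> coordinates has bounded mean.\<close>

lemma abs_le_truncated:
  fixes x :: real
  assumes r1: "r \<le> 1" and N: "2 \<le> N"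
  shows "\<bar>x\<bar> \<le> 2 * (2 * ln N) powr (1 / r - 1) * (1/2 * \<bar>x\<bar> powr r)
    + (4 / r) powr (1 / r) * (exp (3/4 * \<bar>x\<bar> powr r) / N)"
proof (cases "\<bar>x\<bar> powr r \<le> 2 * ln N")
  case True
  have "\<bar>x\<bar> = (\<bar>x\<bar> powr r) powr (1 / r)" using r_pos by (simp add: powr_powr)
  also have "\<dots> = (\<bar>x\<bar> powr r) powr (1 / r - 1) * (\<bar>x\<bar> powr r)"
    by (cases "x = 0") (auto simp: powr_diff)
  also have "\<dots> \<le> (2 * ln N) powr (1 / r - 1) * (\<bar>x\<bar> powr r)"
    using True r1 r_pos by (intro mult_right_mono powr_mono2) (auto simp: field_simps)
  finally have "\<bar>x\<bar> \<le> 2 * (2 * ln N) powr (1 / r - 1) * (1/2 * \<bar>x\<bar> powr r)" by simp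
  moreover have "0 \<le> (4 / r) powr (1 / r) * (exp (3/4 * \<bar>x\<bar> powr r) / N)" by simp
  ultimately show ?thesis by linarith
next
  case False
  have "\<bar>x\<bar> = (\<bar>x\<bar> powr r) powr (1 / r)" using r_pos by (simp add: powr_powr)
  also have "\<dots> \<le> (4 / r) powr (1 / r) * exp (\<bar>x\<bar> powr r / 4)"
    using powr_le_exp_quarter[of "\<bar>x\<bar> powr r" "1 / r"] r_pos by simp
  \<comment> \<open>Beyond the threshold, \<open>\<bar>x\<bar> powr r / 2\<close> exceeds
    \<open>ln N\<close>, and a quarter is three quarters minus a half. The weight \<open>3/4\<close>
    stays below \<open>1\<close>, so the exponential moment is finite.\<close>
  also have "exp (\<bar>x\<bar> powr r / 4) \<le> exp (3/4 * \<bar>x\<bar> powr r - ln N)"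
    using False by simp
  also have "\<dots> = exp (3/4 * \<bar>x\<bar> powr r) / N" using N by (simp add: exp_diff)
  finally have "\<bar>x\<bar> \<le> (4 / r) powr (1 / r) * (exp (3/4 * \<bar>x\<bar> powr r) / N)"
    by (simp add: mult_left_mono)
  moreover have "0 \<le> 2 * (2 * ln N) powr (1 / r - 1) * (1/2 * \<bar>x\<bar> powr r)" by simp
  ultimately show ?thesis by linarith
qed

text \<open>A union bound in exponential form. For each set the main part is a multiple of half the
  sum of the \<open>\<bar>X i\<bar> powr r\<close>; for such a value \<open>u\<close> one uses
  \<open>u \<le> a + exp (u - a)\<close> and sums the exponentials over \<open>F\<close>. The rare
  large values enter through one remainder common to all sets.\<close>

lemma exp_sup_indicators_le:
  assumes r1: "r \<le> 1" and N: "2 \<le> N"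
    and F: "finite F" "F \<noteq> {}" "\<And>S. S \<in> F \<Longrightarrow> S \<subseteq> {..<N}" "\<And>S. S \<in> F \<Longrightarrow> card S \<le> m"
  shows "exp_sup M N X (insert (\<lambda>_. 0) (indicator ` F)) \<le>
    2 * (2 * ln N) powr (1 / r - 1) * (ln (card F) + m * ln 2 + 1) + 4 * (4 / r) powr (1 / r)"
proof -
  \<comment> \<open>The sum over \<open>F\<close> of the exponential moments is at most
    \<open>card F * 2 ^ m\<close>; \<open>a\<close> is the logarithm of this bound, so
    \<open>H\<close> has mean at most \<open>1\<close>.\<close>
  define a where "a = ln (card F) + m * ln (2::real)"
  define l where "l = 2 * (2 * ln N) powr (1 / r - 1)"
  define K where "K = (4 / r) powr (1 / r)"
  define H where "H \<omega> = (\<Sum>S\<in>F. exp (1/2 * (\<Sum>i\<in>S. \<bar>X i \<omega>\<bar> powr r)) * exp (- a))" for \<omega>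
  define R where "R \<omega> = (\<Sum>i<N. exp (3/4 * \<bar>X i \<omega>\<bar> powr r) / N)" for \<omega>
  have cF: "0 < card F" using F by (simp add: card_gt_0_iff)
  then have "1 \<le> real (card F)" by simp
  then have a0: "0 \<le> a" by (simp add: a_def)
  have l0: "0 \<le> l" and K0: "0 \<le> K" by (auto simp: l_def K_def)
  have H0: "0 \<le> H \<omega>" and R0: "0 \<le> R \<omega>" for \<omega>
    by (auto simp: H_def R_def intro!: sum_nonneg)
  have Hint: "integrable M H" "expectation H \<le> 1"
  proof -
    show "integrable M H"
      unfolding H_def by (intro Bochner_Integration.integrable_sum integrable_mult_left exp_moment_sum F(3))
    have "expectation H = (\<Sum>S\<in>F. 2 ^ card S * exp (- a))"
      unfolding H_def using F(3)
      by (subst Bochner_Integration.integral_sum) (auto simp: exp_moment_sum simp del: times_divide_eq_left)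
    also have "\<dots> \<le> (\<Sum>S\<in>F. 2 ^ m * exp (- a))"
      using F(4) by (intro sum_mono mult_right_mono power_increasing) auto
    also have "\<dots> = card F * 2 ^ m * exp (- a)" by simp
    also have "exp (- a) = 1 / (card F * 2 ^ m)"
    proof -
      have "exp a = card F * 2 ^ m"
        using cF by (simp add: a_def exp_add exp_of_nat_mult)
      then show ?thesis by (simp add: exp_minus inverse_eq_divide)
    qed
    finally show "expectation H \<le> 1" using cF by simp
  qed
  have Rint: "integrable M R" "expectation R = 4"
  proof -
    have E: "integrable M (\<lambda>\<omega>. exp (3/4 * \<bar>X i \<omega>\<bar> powr r))"
      "expectation (\<lambda>\<omega>. exp (3/4 * \<bar>X i \<omega>\<bar> powr r)) = 4" if "i < N" for i
      using symmetric_weibull_exp_moment[OF r_pos weibull, of i "3/4"] that by auto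
    show "integrable M R"
      unfolding R_def by (intro Bochner_Integration.integrable_sum integrable_divide_zero E) auto
    show "expectation R = 4"
      unfolding R_def using E N by (subst Bochner_Integration.integral_sum) auto
  qed
  have sup_le: "(SUP t\<in>insert (\<lambda>_. 0) (indicator ` F). lin_comb N X t \<omega>) \<le> l * (a + H \<omega>) + K * R \<omega>"
    for \<omega>
  proof (rule cSUP_least)
    fix t :: "nat \<Rightarrow> real" assume "t \<in> insert (\<lambda>_. 0) (indicator ` F)"
    then consider "t = (\<lambda>_. 0)" | S where "S \<in> F" "t = indicator S" by auto
    then show "lin_comb N X t \<omega> \<le> l * (a + H \<omega>) + K * R \<omega>"
    proof cases
      case 1
      then show ?thesis using l0 K0 a0 H0 R0 by (simp add: lin_comb_def)
    next
      case 2
      let ?U = "1/2 * (\<Sum>i\<in>S. \<bar>X i \<omega>\<bar> powr r)"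
      have "lin_comb N X t \<omega> = (\<Sum>i\<in>{..<N} \<inter> S. X i \<omega>)"
        unfolding lin_comb_def 2(2) sum.inter_restrict[OF finite_lessThan]
        by (intro sum.cong) (auto simp: indicator_def)
      also have "{..<N} \<inter> S = S" using F(3)[OF 2(1)] by auto
      also have "(\<Sum>i\<in>S. X i \<omega>) \<le> (\<Sum>i\<in>S. l * (1/2 * \<bar>X i \<omega>\<bar> powr r)
          + K * (exp (3/4 * \<bar>X i \<omega>\<bar> powr r) / N))"
        unfolding l_def K_def
        by (rule sum_mono) (rule order_trans[OF abs_ge_self abs_le_truncated[OF r1 N]])
      also have "\<dots> = l * ?U + K * (\<Sum>i\<in>S. exp (3/4 * \<bar>X i \<omega>\<bar> powr r) / N)"
        by (simp only: sum.distrib sum_distrib_left)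
      also have "\<dots> \<le> l * ?U + K * R \<omega>"
        unfolding R_def using K0 F(3)[OF 2(1)]
        by (intro add_left_mono mult_left_mono sum_mono2) auto
      also have "?U \<le> a + H \<omega>"
      proof -
        have "?U \<le> a + exp (?U - a)" using exp_ge_add_one_self[of "?U - a"] by linarith
        also have "exp (?U - a) = exp ?U * exp (- a)" by (simp only: exp_add[symmetric] diff_conv_add_uminus)
        also have "\<dots> \<le> H \<omega>"
          unfolding H_def
          by (rule member_le_sum[of S F "\<lambda>S. exp (1/2 * (\<Sum>i\<in>S. \<bar>X i \<omega>\<bar> powr r)) * exp (- a)"])
            (use 2 F in auto)
        finally show ?thesis by simp
      qed
      finally show ?thesis using l0 by (simp add: mult_left_mono)
    qed
  qed auto
  have "exp_sup M N X (insert (\<lambda>_. 0) (indicator ` F)) \<le> expectation (\<lambda>\<omega>. l * (a + H \<omega>) + K * R \<omega>)"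
    unfolding exp_sup_def
  \<comment> \<open>The majorant is nonnegative, so it dominates even the default value
    \<open>0\<close> of the integral.\<close>
  proof (rule integral_mono'[OF _ sup_le])
    show "integrable M (\<lambda>\<omega>. l * (a + H \<omega>) + K * R \<omega>)"
      using Hint(1) Rint(1) by simp
    show "0 \<le> l * (a + H \<omega>) + K * R \<omega>" for \<omega>
      using l0 K0 a0 H0 R0 by simp
  qed
  also have "\<dots> = l * (a + expectation H) + K * 4"
    using Hint(1) Rint by (simp add: prob_space)
  also have "\<dots> \<le> l * (a + 1) + K * 4"
    using Hint(2) l0 by (intro add_right_mono mult_left_mono) auto
  finally show ?thesis by (simp add: a_def l_def K_def algebra_simps)
qed

lemma exp_sup_nonneg:
  assumes "finite T" and "(\<lambda>_. 0) \<in> T"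
  shows "0 \<le> exp_sup M N X T"
  unfolding exp_sup_def
proof (rule Bochner_Integration.integral_nonneg)
  fix \<omega>
  have "lin_comb N X (\<lambda>_. 0) \<omega> \<le> (SUP t\<in>T. lin_comb N X t \<omega>)"
    using assms by (intro cSUP_upper) auto
  then show "0 \<le> (SUP t\<in>T. lin_comb N X t \<omega>)" by (simp add: lin_comb_def)
qed

end

subsection \<open>Graphs of polynomials\<close>

text \<open>The point \<open>(x, v)\<close> of a graph is encoded as the coordinate \<open>v * m + x\<close>. Working over the natural
  numbers instead of a finite field only enlarges the value range, hence \<open>N\<close>, by a factor
  independent of \<open>Q\<close>.\<close>

definition graph_code :: "nat \<Rightarrow> nat \<Rightarrow> (nat \<Rightarrow> nat) \<Rightarrow> nat set" where
  "graph_code d m c = (\<lambda>x. (\<Sum>j<d. c j * x ^ j) * m + x) ` {..<m}"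

lemma card_graph_code: "card (graph_code d m c) = m"
proof -
  have "inj_on (\<lambda>x. (\<Sum>j<d. c j * x ^ j) * m + x) {..<m}"
  proof (rule inj_onI)
    fix x y assume "x \<in> {..<m}" "y \<in> {..<m}"
      and "(\<Sum>j<d. c j * x ^ j) * m + x = (\<Sum>j<d. c j * y ^ j) * m + y"
    then have "((\<Sum>j<d. c j * x ^ j) * m + x) mod m = ((\<Sum>j<d. c j * y ^ j) * m + y) mod m"
      by (simp only:)
    then show "x = y" using \<open>x \<in> {..<m}\<close> \<open>y \<in> {..<m}\<close> by simp
  qed
  then show ?thesis by (simp add: graph_code_def card_image)
qed

lemma finite_graph_code [simp]: "finite (graph_code d m c)"
  by (simp add: graph_code_def)

lemma graph_code_less:
  assumes c: "c \<in> {..<d} \<rightarrow>\<^sub>E {..<Q}" and d: "0 < d"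
  shows "graph_code d m c \<subseteq> {..<d * m ^ d * Q * m}"
proof
  fix i assume "i \<in> graph_code d m c"
  then obtain x where x: "x < m" "i = (\<Sum>j<d. c j * x ^ j) * m + x"
    by (auto simp: graph_code_def)
  have "c j * x ^ j < Q * m ^ d" if "j < d" for j
  proof -
    have "c j < Q" using c that by auto
    moreover have "x ^ j \<le> m ^ d"
    proof -
      have "x ^ j \<le> m ^ j" using x by (intro power_mono) auto
      also have "\<dots> \<le> m ^ d" using x that by (intro power_increasing) auto
      finally show ?thesis .
    qed
    moreover have "0 < m ^ d" using x by simp
    ultimately have "c j * m ^ d < Q * m ^ d" "c j * x ^ j \<le> c j * m ^ d" by simp_all
    then show ?thesis by linarith
  qed
  then have "(\<Sum>j<d. c j * x ^ j) < (\<Sum>j<d. Q * m ^ d)"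
    using d by (intro sum_strict_mono) auto
  \<comment> \<open>Strictness leaves room for the abscissa: \<open>v * m + x\<close> with
    \<open>x < m\<close> lies below \<open>Suc v * m\<close>.\<close>
  then have "Suc (\<Sum>j<d. c j * x ^ j) \<le> d * m ^ d * Q" by (simp add: algebra_simps)
  then have "Suc (\<Sum>j<d. c j * x ^ j) * m \<le> d * m ^ d * Q * m" by (rule mult_le_mono1)
  then show "i \<in> {..<d * m ^ d * Q * m}" using x by simp
qed

text \<open>Otherwise the difference, read over the reals, is a nonzero polynomial of degree below
  \<open>n\<close> with at least \<open>n\<close> roots.\<close>

lemma poly_eq_if_card_agree:
  fixes a b :: "nat \<Rightarrow> nat"
  assumes V: "finite V" "n \<le> card V"
    and eq: "\<And>x. x \<in> V \<Longrightarrow> (\<Sum>j<n. a j * x ^ j) = (\<Sum>j<n. b j * x ^ j)" and j: "j < n"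
  shows "a j = b j"
proof (rule ccontr)
  assume neq: "a j \<noteq> b j"
  obtain k where k: "n = Suc k" using j by (cases n) auto
  define e where "e i = real (a i) - real (b i)" for i
  have root: "real ` V \<subseteq> {z. (\<Sum>i\<le>k. e i * z ^ i) = 0}"
  proof clarify
    fix x assume "x \<in> V"
    then have "real (\<Sum>j<n. a j * x ^ j) = real (\<Sum>j<n. b j * x ^ j)" using eq by simp
    then show "(\<Sum>i\<le>k. e i * real x ^ i) = 0"
      by (simp add: e_def k lessThan_Suc_atMost left_diff_distrib sum_subtractf)
  qed
  have "finite {z. (\<Sum>i\<le>k. e i * z ^ i) = 0} \<and> card {z. (\<Sum>i\<le>k. e i * z ^ i) = 0} \<le> k"
    by (rule Transcendental.polyfun_rootbound[where k = j]) (use neq j k in \<open>auto simp: e_def\<close>)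
  then have "card (real ` V) \<le> k" using root card_mono le_trans by blast
  moreover have "card (real ` V) = card V" by (intro card_image) (auto intro: inj_onI)
  ultimately show False using V k by simp
qed

text \<open>Points of one graph have different abscissas, so \<open>A\<close> prescribes the
  polynomial at \<open>h\<close> places. The coefficients of index at least \<open>h\<close> then
  determine the lower ones, and they can be chosen in \<open>Q ^ (d - h)\<close> ways.\<close>

lemma card_graph_code_containing:
  assumes h: "card A = h" "h \<le> d"
  shows "card {c \<in> {..<d} \<rightarrow>\<^sub>E {..<Q}. A \<subseteq> graph_code d m c} \<le> Q ^ (d - h)"
proof -
  let ?F = "{c \<in> {..<d} \<rightarrow>\<^sub>E {..<Q}. A \<subseteq> graph_code d m c}"
  have "inj_on (\<lambda>c. restrict c {h..<d}) ?F"
  proof (rule inj_onI)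
    fix c c' assume c: "c \<in> ?F" and c': "c' \<in> ?F" and eq: "restrict c {h..<d} = restrict c' {h..<d}"
    have tail: "c j = c' j" if "h \<le> j" "j < d" for j
      using fun_cong[OF eq, of j] that by (simp add: restrict_def)
    have modA: "i mod m < m \<and> (\<Sum>j<d. b j * (i mod m) ^ j) * m + i mod m = i"
      if "i \<in> graph_code d m b" for i b
      using that by (auto simp: graph_code_def)
    define V where "V = (\<lambda>i. i mod m) ` A"
    have "inj_on (\<lambda>i. i mod m) A"
    proof (rule inj_onI)
      fix i i' assume "i \<in> A" "i' \<in> A" and eq: "i mod m = i' mod m"
      then have "i \<in> graph_code d m c" "i' \<in> graph_code d m c" using c by auto
      then have "i = (\<Sum>j<d. c j * (i mod m) ^ j) * m + i mod m"
        "i' = (\<Sum>j<d. c j * (i' mod m) ^ j) * m + i' mod m"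
        using modA by (auto simp del: mod_mult_self3)
      then show "i = i'" using eq by metis
    qed
    \<comment> \<open>For \<open>h = 0\<close> the set \<open>A\<close> may be infinite, because
      \<open>card\<close> is then \<open>0\<close>.\<close>
    then have V: "finite A" "card V = h" if "0 < h"
      using h that by (auto simp: V_def card_image intro: card_ge_0_finite)
    \<comment> \<open>Cancelling the common higher terms leaves two polynomials with
      \<open>h\<close> coefficients that agree on \<open>V\<close>.\<close>
    have agree: "(\<Sum>j<h. c j * x ^ j) = (\<Sum>j<h. c' j * x ^ j)" if x: "x \<in> V" for x
    proof -
      obtain i where i: "i \<in> A" "x = i mod m" using x by (auto simp: V_def)
      have iS: "i \<in> graph_code d m c" "i \<in> graph_code d m c'" using c c' i(1) by auto
      have "i mod m < m" using modA[OF iS(1)] by (rule conjunct1)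
      then have "0 < m" by (cases m) auto
      moreover have "(\<Sum>j<d. c j * x ^ j) * m + x = (\<Sum>j<d. c' j * x ^ j) * m + x"
        using modA[OF iS(1)] modA[OF iS(2)] unfolding i(2) by (elim conjE) (rule trans, assumption, rule sym)
      ultimately have "(\<Sum>j<d. c j * x ^ j) = (\<Sum>j<d. c' j * x ^ j)" by simp
      moreover have "(\<Sum>j<d. b j * x ^ j) = (\<Sum>j<h. b j * x ^ j) + (\<Sum>j=h..<d. b j * x ^ j)"
        for b :: "nat \<Rightarrow> nat"
        using h(2) by (simp add: lessThan_atLeast0 sum.atLeastLessThan_concat)
      moreover have "(\<Sum>j=h..<d. c j * x ^ j) = (\<Sum>j=h..<d. c' j * x ^ j)"
        using tail by (intro sum.cong) auto
      ultimately show ?thesis by simp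
    qed
    have head: "c j = c' j" if "j < h" for j
      by (rule poly_eq_if_card_agree[of V h]) (use V agree that in \<open>auto simp: V_def\<close>)
    show "c = c'"
    proof (rule PiE_ext)
      show "c \<in> {..<d} \<rightarrow>\<^sub>E {..<Q}" "c' \<in> {..<d} \<rightarrow>\<^sub>E {..<Q}" using c c' by auto
      fix j assume "j \<in> {..<d}"
      then show "c j = c' j" using head[of j] tail[of j] by (cases "j < h") auto
    qed
  qed
  moreover have "(\<lambda>c. restrict c {h..<d}) ` ?F \<subseteq> {h..<d} \<rightarrow>\<^sub>E {..<Q}"
    by (auto simp: PiE_def Pi_def)
  ultimately have "card ?F \<le> card ({h..<d} \<rightarrow>\<^sub>E {..<Q})"
    by (intro card_inj_on_le) (auto intro: finite_PiE)
  also have "\<dots> = Q ^ (d - h)" by (simp add: card_PiE)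
  finally show ?thesis .
qed

text \<open>Union bound over the \<open>h\<close>-point subsets of \<open>J\<close>, of which there
  are at most \<open>card J ^ h\<close>.\<close>

lemma card_graph_code_meeting:
  assumes J: "finite J" and h: "h \<le> d"
  shows "card {c \<in> {..<d} \<rightarrow>\<^sub>E {..<Q}. h \<le> card (graph_code d m c \<inter> J)} \<le> card J ^ h * Q ^ (d - h)"
proof -
  let ?G = "\<lambda>A. {c \<in> {..<d} \<rightarrow>\<^sub>E {..<Q}. A \<subseteq> graph_code d m c}"
  let ?A = "{A. A \<subseteq> J \<and> card A = h}"
  have finA: "finite ?A" using J by simp
  have finG: "finite (?G A)" for A by (rule finite_subset[OF _ finite_PiE[of "{..<d}" "\<lambda>_. {..<Q}"]]) auto
  have "{c \<in> {..<d} \<rightarrow>\<^sub>E {..<Q}. h \<le> card (graph_code d m c \<inter> J)} \<subseteq> (\<Union>A\<in>?A. ?G A)"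
  proof clarify
    fix c assume "c \<in> {..<d} \<rightarrow>\<^sub>E {..<Q}" and "h \<le> card (graph_code d m c \<inter> J)"
    moreover then obtain A where "A \<subseteq> graph_code d m c \<inter> J" "card A = h"
      by (meson obtain_subset_with_card_n)
    ultimately show "c \<in> (\<Union>A\<in>?A. ?G A)" by auto
  qed
  then have "card {c \<in> {..<d} \<rightarrow>\<^sub>E {..<Q}. h \<le> card (graph_code d m c \<inter> J)} \<le> card (\<Union>A\<in>?A. ?G A)"
    using finA finG by (intro card_mono) auto
  also have "\<dots> \<le> (\<Sum>A\<in>?A. card (?G A))" by (rule card_UN_le[OF finA])
  also have "\<dots> \<le> (\<Sum>A\<in>?A. Q ^ (d - h))"
    using card_graph_code_containing h by (intro sum_mono) auto
  also have "\<dots> = (card J choose h) * Q ^ (d - h)" using J by (simp add: n_subsets)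
  also have "\<dots> \<le> card J ^ h * Q ^ (d - h)"
  proof (rule mult_le_mono1)
    have "(card J choose h) * 1 \<le> (card J choose h) * fact h" by (intro mult_le_mono2 fact_ge_1)
    also have "\<dots> \<le> card J ^ h" by (rule binomial_fact_pow)
    finally show "card J choose h \<le> card J ^ h" by simp
  qed
  finally show ?thesis .
qed

lemma sum_inverse_squares_less:
  "(\<Sum>k=1..n. 1 / (real k + 2)\<^sup>2) < 1"
proof -
  \<comment> \<open>The induction runs on a sharper bound with the telescoping increment
    \<open>1 / ((n + 2) * (n + 3))\<close>.\<close>
  have "(\<Sum>k=1..n. 1 / (real k + 2)\<^sup>2) \<le> 1 / 2 - 1 / (real n + 2)"
  proof (induction n)
    case (Suc n)
    have "1 / (real (Suc n) + 2)\<^sup>2 \<le> 1 / ((real n + 2) * (real n + 3))"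
      by (intro divide_left_mono) (auto simp: power2_eq_square intro!: mult_mono)
    also have "\<dots> = 1 / (real n + 2) - 1 / (real (Suc n) + 2)" by (simp add: field_simps)
    finally show ?case using Suc by simp
  qed simp
  also have "\<dots> < 1" by (simp add: field_simps)
  finally show ?thesis .
qed

text \<open>If \<open>R ^ (h - 1) < k + 2 \<le> R ^ h\<close>, a graph whose sum for
  \<open>y k\<close> reaches \<open>m\<close> has at least \<open>h\<close> points with
  \<open>\<bar>y k i\<bar> \<ge> 1 / 2\<close>. By counting, at most a fraction
  \<open>1 / (k + 2)\<^sup>2\<close> of the coefficient functions is bad for \<open>k\<close>. For
  \<open>k + 2 > R ^ d\<close> none is bad, by \<open>tiny\<close>. The fractions sum to less than
  \<open>1\<close>, so some function is never bad.\<close>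

lemma exists_graph_code_avoiding:
  fixes y :: "nat \<Rightarrow> nat \<Rightarrow> real"
  assumes d: "0 < d" and m: "0 < m" and R: "2 \<le> R" and N: "N = d * m ^ d * R ^ 4 * m"
    and J: "\<And>k. 1 \<le> k \<Longrightarrow> card {i. i < N \<and> 1 / 2 \<le> \<bar>y k i\<bar>} \<le> R\<^sup>2"
    and small: "\<And>k h i. 1 \<le> k \<Longrightarrow> 1 \<le> h \<Longrightarrow> h \<le> d \<Longrightarrow> R ^ h < k + 2 \<Longrightarrow> i < N \<Longrightarrow> 2 * h * \<bar>y k i\<bar> < m"
    and tiny: "\<And>k i. 1 \<le> k \<Longrightarrow> R ^ d < k + 2 \<Longrightarrow> i < N \<Longrightarrow> \<bar>y k i\<bar> < 1"
  obtains c where "c \<in> {..<d} \<rightarrow>\<^sub>E {..<R ^ 4}" "\<And>k. 1 \<le> k \<Longrightarrow> (\<Sum>i\<in>graph_code d m c. \<bar>y k i\<bar>) < m"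
proof -
  define F where "F = {..<d} \<rightarrow>\<^sub>E {..<R ^ 4}"
  define B where "B k = {c \<in> F. m \<le> (\<Sum>i\<in>graph_code d m c. \<bar>y k i\<bar>)}" for k
  have finF: "finite F" unfolding F_def by (intro finite_PiE) auto
  have cardF: "card F = R ^ (4 * d)" by (simp add: F_def card_PiE power_mult)
  have sub: "graph_code d m c \<subseteq> {..<N}" if "c \<in> F" for c
    using graph_code_less[of c d "R ^ 4" m] that d by (simp add: F_def N)
  have B_empty: "B k = {}" if k: "1 \<le> k" "R ^ d < k + 2" for k
  proof -
    have "(\<Sum>i\<in>graph_code d m c. \<bar>y k i\<bar>) < m" if c: "c \<in> F" for c
    proof -
      have "graph_code d m c \<noteq> {}" using card_graph_code[of d m c] m by auto
      then have "(\<Sum>i\<in>graph_code d m c. \<bar>y k i\<bar>) < (\<Sum>i\<in>graph_code d m c. 1)"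
        using tiny[OF k] sub[OF c] by (intro sum_strict_mono) auto
      then show ?thesis by (simp add: card_graph_code)
    qed
    then show ?thesis by (auto simp: B_def not_le[symmetric])
  qed
  have B_card: "real (card (B k)) \<le> real (R ^ (4 * d)) * (1 / (real k + 2)\<^sup>2)"
    if k: "1 \<le> k" "k + 2 \<le> R ^ d" for k
  proof -
    \<comment> \<open>Minimality gives \<open>R ^ (h - 1) < k + 2\<close>, so \<open>small\<close>
      can be used with \<open>h - 1\<close>, while \<open>k + 2 \<le> R ^ h\<close> yields the
      required fraction.\<close>
    define h where "h = (LEAST h. k + 2 \<le> R ^ h)"
    have hk: "k + 2 \<le> R ^ h" unfolding h_def by (rule LeastI[of _ d]) (rule k)
    have hd: "h \<le> d" unfolding h_def by (rule Least_le) (rule k)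
    have h0: "h \<noteq> 0" using hk by (cases h) auto
    have hk': "R ^ (h - 1) < k + 2"
      using not_less_Least[of "h - 1" "\<lambda>h. k + 2 \<le> R ^ h", folded h_def] h0 by simp
    define Jk where "Jk = {i. i < N \<and> 1 / 2 \<le> \<bar>y k i\<bar>}"
    have finJ: "finite Jk" by (simp add: Jk_def)
    have "B k \<subseteq> {c \<in> {..<d} \<rightarrow>\<^sub>E {..<R ^ 4}. h \<le> card (graph_code d m c \<inter> Jk)}"
    proof clarify
      fix c assume "c \<in> B k"
      then have c: "c \<in> F" "m \<le> (\<Sum>i\<in>graph_code d m c. \<bar>y k i\<bar>)" by (auto simp: B_def)
      let ?S = "graph_code d m c"
      have "h \<le> card (?S \<inter> Jk)"
      proof (rule ccontr)
        \<comment> \<open>At most \<open>h - 1\<close> points are large, each below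
          \<open>m / (2 * (h - 1))\<close>, and the others contribute at most \<open>1 / 2\<close>
          each; together this stays below \<open>m\<close>.\<close>
        assume "\<not> h \<le> card (?S \<inter> Jk)"
        then have a: "card (?S \<inter> Jk) \<le> h - 1" by simp
        have "(\<Sum>i\<in>?S. \<bar>y k i\<bar>) = (\<Sum>i\<in>?S \<inter> Jk. \<bar>y k i\<bar>) + (\<Sum>i\<in>?S - Jk. \<bar>y k i\<bar>)"
          by (rule sum.Int_Diff) simp
        moreover have "(\<Sum>i\<in>?S - Jk. \<bar>y k i\<bar>) \<le> real m / 2"
        proof -
          have "(\<Sum>i\<in>?S - Jk. \<bar>y k i\<bar>) \<le> (\<Sum>i\<in>?S - Jk. 1 / 2)"
            using sub[OF c(1)] by (intro sum_mono) (auto simp: Jk_def)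
          also have "\<dots> \<le> real m / 2"
            using card_mono[of ?S "?S - Jk"] by (simp add: card_graph_code)
          finally show ?thesis .
        qed
        moreover have "(\<Sum>i\<in>?S \<inter> Jk. \<bar>y k i\<bar>) < real m / 2"
        \<comment> \<open>The empty case absorbs \<open>h = 1\<close>, where \<open>small\<close>
          does not apply to \<open>h - 1 = 0\<close>.\<close>
        proof (cases "?S \<inter> Jk = {}")
          case True
          then show ?thesis using m by simp
        next
          case False
          then have "0 < card (?S \<inter> Jk)" by (simp add: card_gt_0_iff)
          then have h1: "1 \<le> h - 1" using a by simp
          have "(\<Sum>i\<in>?S \<inter> Jk. \<bar>y k i\<bar>) < (\<Sum>i\<in>?S \<inter> Jk. real m / (2 * real (h - 1)))"
            using False small[OF k(1) h1 _ hk'] hd h1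
            by (intro sum_strict_mono) (auto simp: Jk_def field_simps)
          also have "\<dots> \<le> real (h - 1) * (real m / (2 * real (h - 1)))"
            using a by (simp only: sum_constant) (intro mult_right_mono, auto)
          also have "\<dots> = real m / 2" using h1 by (simp add: field_simps)
          finally show ?thesis .
        qed
        ultimately show False using c(2) by linarith
      qed
      then show "c \<in> {..<d} \<rightarrow>\<^sub>E {..<R ^ 4} \<and> h \<le> card (?S \<inter> Jk)" using c by (simp add: F_def)
    qed
    then have "card (B k) \<le> card {c \<in> {..<d} \<rightarrow>\<^sub>E {..<R ^ 4}. h \<le> card (graph_code d m c \<inter> Jk)}"
      using finF by (intro card_mono) (auto simp: F_def)
    also have "\<dots> \<le> card Jk ^ h * (R ^ 4) ^ (d - h)"
      by (rule card_graph_code_meeting[OF finJ hd])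
    also have "\<dots> \<le> (R\<^sup>2) ^ h * (R ^ 4) ^ (d - h)"
      using J[OF k(1)] by (intro mult_le_mono1 power_mono) (auto simp: Jk_def)
    \<comment> \<open>The exponents fit: \<open>2 * h\<close> from the large coordinates and
      \<open>2 * h\<close> from \<open>(k + 2)\<^sup>2\<close> make up for the \<open>4 * h\<close>
      missing from \<open>R ^ (4 * d)\<close>.\<close>
    finally have "card (B k) * (k + 2)\<^sup>2 \<le> (R\<^sup>2) ^ h * (R ^ 4) ^ (d - h) * (R ^ h)\<^sup>2"
      using hk by (intro mult_le_mono power_mono) auto
    also have "\<dots> = R ^ (2 * h + 4 * (d - h) + 2 * h)"
      by (simp only: power_mult[symmetric] power_add mult.commute[of h 2])
    also have "2 * h + 4 * (d - h) + 2 * h = 4 * d" using hd by simp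
    finally have "real (card (B k) * (k + 2)\<^sup>2) \<le> real (R ^ (4 * d))" by (simp only: of_nat_le_iff)
    then show ?thesis by (simp add: field_simps)
  qed
  have "\<exists>c\<in>F. \<forall>k\<ge>1. c \<notin> B k"
  proof (rule ccontr)
    assume none: "\<not> (\<exists>c\<in>F. \<forall>k\<ge>1. c \<notin> B k)"
    have "F \<subseteq> (\<Union>k\<in>{1..R ^ d}. B k)"
    proof (intro subsetI)
      fix c assume "c \<in> F"
      with none obtain k where k: "1 \<le> k" "c \<in> B k" by blast
      then have "\<not> R ^ d < k + 2" using B_empty[of k] by blast
      then show "c \<in> (\<Union>k\<in>{1..R ^ d}. B k)" using k by (intro UN_I[of k]) auto
    qed
    then have "card F \<le> card (\<Union>k\<in>{1..R ^ d}. B k)"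
      using finF by (intro card_mono) (auto simp: B_def)
    also have "\<dots> \<le> (\<Sum>k=1..R ^ d. card (B k))" by (rule card_UN_le) simp
    finally have "real (R ^ (4 * d)) \<le> (\<Sum>k=1..R ^ d. real (card (B k)))"
      unfolding cardF by (metis of_nat_le_iff of_nat_sum)
    also have "\<dots> \<le> (\<Sum>k=1..R ^ d. real (R ^ (4 * d)) * (1 / (real k + 2)\<^sup>2))"
    proof (rule sum_mono)
      fix k assume "k \<in> {1..R ^ d}"
      then show "real (card (B k)) \<le> real (R ^ (4 * d)) * (1 / (real k + 2)\<^sup>2)"
        using B_card[of k] B_empty[of k] by (cases "k + 2 \<le> R ^ d") auto
    qed
    also have "\<dots> = real (R ^ (4 * d)) * (\<Sum>k=1..R ^ d. 1 / (real k + 2)\<^sup>2)"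
      by (simp only: sum_distrib_left)
    also have "\<dots> < real (R ^ (4 * d)) * 1"
      using R by (intro mult_strict_left_mono sum_inverse_squares_less) simp
    finally show False by simp
  qed
  then show ?thesis using that by (auto simp: B_def F_def not_le)
qed

text \<open>Summed over \<open>S\<close>, the representation writes \<open>card S\<close> as a
  combination of the sums of the \<open>v j\<close> over \<open>S\<close>, with absolute weights of
  total at most \<open>1\<close>. One of these sums must be at least that large in absolute
  value.\<close>

lemma absconv_indicator_witness:
  fixes S :: "nat set"
  assumes S: "finite S" "S \<noteq> {}" and mem: "indicator S \<in> absconv A"
  obtains v where "v \<in> A" "real (card S) \<le> (\<Sum>i\<in>S. \<bar>v i\<bar>)"
proof -
  obtain m :: nat and a :: "nat \<Rightarrow> real" and v where
    eq: "indicator S = (\<lambda>i. \<Sum>j=1..m. a j * v j i)"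
    and v: "\<And>j. j \<in> {1..m} \<Longrightarrow> v j \<in> A" and a: "(\<Sum>j=1..m. \<bar>a j\<bar>) \<le> 1"
    using mem unfolding absconv_def by blast
  have c0: "0 < real (card S)" using S by (simp add: card_gt_0_iff)
  have "\<exists>j\<in>{1..m}. real (card S) \<le> (\<Sum>i\<in>S. \<bar>v j i\<bar>)"
  proof (rule ccontr)
    assume "\<not> ?thesis"
    then have lt: "(\<Sum>i\<in>S. \<bar>v j i\<bar>) < real (card S)" if "j \<in> {1..m}" for j
      using that by force
    have "real (card S) = (\<Sum>i\<in>S. indicator S i)" by simp
    also have "\<dots> = (\<Sum>i\<in>S. \<Sum>j=1..m. a j * v j i)" by (simp only: eq)
    also have "\<dots> = (\<Sum>j=1..m. a j * (\<Sum>i\<in>S. v j i))"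
      by (subst sum.swap) (simp add: sum_distrib_left)
    also have "\<dots> \<le> (\<Sum>j=1..m. \<bar>a j\<bar> * (\<Sum>i\<in>S. \<bar>v j i\<bar>))"
    proof (rule sum_mono)
      fix j
      have "a j * (\<Sum>i\<in>S. v j i) \<le> \<bar>a j\<bar> * \<bar>\<Sum>i\<in>S. v j i\<bar>"
        by (metis abs_ge_self abs_mult)
      also have "\<dots> \<le> \<bar>a j\<bar> * (\<Sum>i\<in>S. \<bar>v j i\<bar>)" by (intro mult_left_mono sum_abs) simp
      finally show "a j * (\<Sum>i\<in>S. v j i) \<le> \<bar>a j\<bar> * (\<Sum>i\<in>S. \<bar>v j i\<bar>)" .
    qed
    also have "\<dots> < real (card S)"
    \<comment> \<open>Strictness needs a nonzero weight; without one the sum is \<open>0\<close>,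
      below \<open>card S\<close>.\<close>
    proof (cases "\<exists>j\<in>{1..m}. a j \<noteq> 0")
      case True
      then obtain j where j: "j \<in> {1..m}" "a j \<noteq> 0" by blast
      have "(\<Sum>j=1..m. \<bar>a j\<bar> * (\<Sum>i\<in>S. \<bar>v j i\<bar>)) < (\<Sum>j=1..m. \<bar>a j\<bar> * real (card S))"
        using j lt by (intro sum_strict_mono_ex1)
          (auto intro!: mult_left_mono less_imp_le[OF lt] bexI[of _ j] mult_strict_left_mono)
      also have "\<dots> \<le> real (card S)"
        using a mult_right_mono[OF a, of "real (card S)"] by (simp add: sum_distrib_right)
      finally show ?thesis .
    qed (use c0 in auto)
    finally show False by simp
  qed
  then show ?thesis using v that by blast
qed

subsection \<open>The counterexample\<close>

text \<open>The terms \<open>4 / 3 * (8 / r) powr (2 / r)\<close> and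
  \<open>4 / 3 * (16 / r) powr (4 / r)\<close> bound the second and fourth moments of a coordinate;
  \<open>exp 3\<close> undoes the cube of the lower bound \<open>exp (-1)\<close> for the second
  moment.\<close>

definition l2_const :: "real \<Rightarrow> real" where
  "l2_const r = 8 * exp 3 * (3 * (4 / 3 * (8 / r) powr (2 / r))\<^sup>2 + 4 / 3 * (16 / r) powr (4 / r))"

definition sup_const :: "real \<Rightarrow> real" where
  "sup_const r = 2 * 2 powr (1 / r) + 4 * (4 / r) powr (1 / r)"

context weibull_family
begin

text \<open>The first moment, and with it every norm of order \<open>q \<ge> 1\<close>, controls the
  Euclidean norm of \<open>y\<close>. This limits how many coordinates can exceed a fixed
  size.\<close>

lemma sum_squares_le_Lp_norm:
  assumes q: "1 \<le> q"
  shows "(\<Sum>i<N. (y i)\<^sup>2) \<le> l2_const r * (Lp_norm M q (lin_comb N X y))\<^sup>2"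
proof -
  define w where "w = 4 / 3 * (8 / r) powr (2 / r)"
  define v where "v = 4 / 3 * (16 / r) powr (4 / r)"
  define B where "B = 3 * w\<^sup>2 + v"
  have l2: "l2_const r = 8 * exp 3 * B" by (simp add: l2_const_def B_def w_def v_def)
  have powr_abs: "\<bar>x\<bar> powr 2 = x\<^sup>2" "\<bar>x\<bar> powr 4 = x ^ 4" for x :: real
    by (cases "x = 0", simp, simp)+
  have w: "expectation (\<lambda>\<omega>. (X i \<omega>)\<^sup>2) \<le> w" and
    v: "expectation (\<lambda>\<omega>. X i \<omega> ^ 4) \<le> v" if "i < N" for i
    using symmetric_weibull_abs_moment(2)[OF r_pos weibull[OF that], of 2]
      symmetric_weibull_abs_moment(2)[OF r_pos weibull[OF that], of 4]
    by (auto simp: powr_abs w_def v_def)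
  have B: "3 * w\<^sup>2 \<le> B" "0 < B"
    using r_pos by (auto simp: B_def v_def intro!: add_nonneg_pos)
  have B4: "expectation (\<lambda>\<omega>. X i \<omega> ^ 4) \<le> B" if "i < N" for i
    using v[OF that] by (simp add: B_def add_increasing)
  have "exp (- 1) ^ 3 * (\<Sum>i<N. (y i)\<^sup>2) \<le> 8 * B * (expectation (\<lambda>\<omega>. \<bar>lin_comb N X y \<omega>\<bar>))\<^sup>2"
    using symmetric_weibull_second_moment_ge[OF r_pos weibull]
    by (intro first_moment_ge[OF _ _ w B4 B]) auto
  also have "\<dots> \<le> 8 * B * (Lp_norm M q (lin_comb N X y))\<^sup>2"
    using expectation_abs_le_Lp_norm[OF q, of y] B by (intro mult_left_mono power_mono) auto
  finally have le: "exp (- 1) ^ 3 * (\<Sum>i<N. (y i)\<^sup>2) \<le> 8 * B * (Lp_norm M q (lin_comb N X y))\<^sup>2" .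
  have e: "exp 3 * exp (- 1) ^ 3 = (1::real)"
    by (simp add: exp_of_nat_mult[symmetric] exp_add[symmetric])
  have "(\<Sum>i<N. (y i)\<^sup>2) = exp 3 * (exp (- 1) ^ 3 * (\<Sum>i<N. (y i)\<^sup>2))"
    unfolding mult.assoc[symmetric] e by simp
  also have "\<dots> \<le> exp 3 * (8 * B * (Lp_norm M q (lin_comb N X y))\<^sup>2)"
    by (rule mult_left_mono[OF le]) simp
  finally show ?thesis by (simp add: l2 mult_ac)
qed

text \<open>There are at most \<open>R ^ (4 * d) \<le> N ^ d\<close> graphs, which contributes
  \<open>d * ln N\<close> to the union bound; the size of \<open>R\<close> keeps
  \<open>m * ln 2 + 1\<close> below \<open>ln N\<close>.\<close>

lemma exp_sup_graph_codes_le: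
  assumes r1: "r \<le> 1" and d: "0 < d" and m: "0 < m" and R: "exp (real m + 1) \<le> real R"
    and N: "N = d * m ^ d * R ^ 4 * m"
  shows "exp_sup M N X (insert (\<lambda>_. 0) (indicator ` graph_code d m ` ({..<d} \<rightarrow>\<^sub>E {..<R ^ 4})))
    \<le> sup_const r * real d * ln N powr (1 / r)"
proof -
  define F where "F = graph_code d m ` ({..<d} \<rightarrow>\<^sub>E {..<R ^ 4})"
  define L where "L = ln (real N)"
  have R1: "1 < real R" using R less_le_trans[of 1 "exp (real m + 1)" "real R"] by simp
  have Rpow: "real R ^ 4 \<le> N"
  proof -
    have "1 * R ^ 4 * 1 \<le> d * m ^ d * R ^ 4 * m"
      using d m by (intro mult_le_mono) (auto simp: Suc_le_eq)
    then show ?thesis by (simp add: N flip: of_nat_power of_nat_mult)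
  qed
  have "real m + 1 \<le> ln (real R)" using R R1 by (subst ln_ge_iff) auto
  also have "\<dots> \<le> ln (real R ^ 4)" using R1 by (simp add: ln_realpow)
  also have "\<dots> \<le> L" unfolding L_def using Rpow R1 by (intro ln_mono) auto
  finally have L: "real m + 1 \<le> L" .
  then have L1: "1 \<le> L" by simp
  have N2: "2 \<le> N"
  proof -
    have "1 < real R ^ 4" using R1 by simp
    then have "1 < real N" using Rpow by linarith
    then show ?thesis by simp
  qed
  have fin: "finite F" unfolding F_def by (intro finite_imageI finite_PiE) auto
  have ne: "F \<noteq> {}" using R1 by (auto simp: F_def PiE_eq_empty_iff lessThan_empty_iff)
  have sub: "S \<subseteq> {..<N}" "card S \<le> m" if "S \<in> F" for S
    using that graph_code_less[OF _ d, of _ "R ^ 4" m] by (auto simp: F_def N card_graph_code)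
  have "card F \<le> card ({..<d} \<rightarrow>\<^sub>E {..<R ^ 4})"
    unfolding F_def by (intro card_image_le finite_PiE) auto
  then have "card F \<le> (R ^ 4) ^ d" by (simp add: card_PiE)
  then have "real (card F) \<le> (real R ^ 4) ^ d" by (simp flip: of_nat_power)
  also have "\<dots> \<le> real N ^ d" using Rpow by (intro power_mono) auto
  finally have "ln (card F) \<le> ln (real N ^ d)"
    using fin ne N2 by (subst ln_le_cancel_iff) (auto simp: card_gt_0_iff)
  then have lnF: "ln (card F) \<le> d * L" using N2 by (simp add: ln_realpow L_def)
  have lnm: "real m * ln 2 \<le> real m * 1" using ln_2_less_1 by (intro mult_left_mono) auto
  have sum: "ln (card F) + m * ln 2 + 1 \<le> 2 * real d * L"
  proof -
    have "L \<le> real d * L" using d L1 by simp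
    then show ?thesis using lnm lnF L by linarith
  qed
  have "exp_sup M N X (insert (\<lambda>_. 0) (indicator ` F)) \<le>
      2 * (2 * L) powr (1 / r - 1) * (ln (card F) + m * ln 2 + 1) + 4 * (4 / r) powr (1 / r)"
    unfolding L_def by (rule exp_sup_indicators_le[OF r1 N2 fin ne sub])
  also have "\<dots> \<le> 2 * (2 * L) powr (1 / r - 1) * (2 * real d * L) + 4 * (4 / r) powr (1 / r)"
    using sum by (intro add_right_mono mult_left_mono) auto
  also have "2 * (2 * L) powr (1 / r - 1) * (2 * real d * L) = 2 * real d * (2 * L) powr (1 / r)"
    using L1 by (simp add: powr_diff)
  also have "\<dots> = 2 * 2 powr (1 / r) * real d * L powr (1 / r)"
    using L1 by (simp add: powr_mult)
  also have "4 * (4 / r) powr (1 / r) \<le> 4 * (4 / r) powr (1 / r) * (real d * L powr (1 / r))"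
  proof -
    have "1 * 1 \<le> real d * L powr (1 / r)"
      using d L1 r_pos by (intro mult_mono ge_one_powr_ge_zero) auto
    then show ?thesis using mult_left_mono[of 1 "real d * L powr (1 / r)" "4 * (4 / r) powr (1 / r)"]
      by simp
  qed
  finally show ?thesis by (simp add: F_def L_def sup_const_def algebra_simps)
qed

end

theorem theorem1p3:
  fixes r :: real
    and M :: "nat \<Rightarrow> 'a measure"
    and X :: "nat \<Rightarrow> nat \<Rightarrow> 'a \<Rightarrow> real"
  assumes "0 < r" and "r < 1"
    and "\<And>N. 1 \<le> N \<Longrightarrow> prob_space (M N)"
    and "\<And>N. 1 \<le> N \<Longrightarrow> prob_space.indep_vars (M N) (\<lambda>_. borel) (X N) {..<N}"
    and "\<And>N i. 1 \<le> N \<Longrightarrow> i < N \<Longrightarrow> symmetric_weibull (M N) r (X N i)"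
  shows "\<not> (\<exists>C::real. \<forall>N\<ge>1. \<forall>T. T \<subseteq> topspace (Euclidean_space N) \<and> finite T \<and> T \<noteq> {} \<longrightarrow>
           (\<exists>y :: nat \<Rightarrow> nat \<Rightarrow> real.
              (\<forall>k\<ge>1. y k \<in> topspace (Euclidean_space N)) \<and>
              difference_set T \<subseteq> absconv {y k | k. k \<ge> 1} \<and>
              (\<forall>k\<ge>1. Lp_norm (M N) (ln (real k + 2)) (lin_comb N (X N) (y k))
                        \<le> C * exp_sup (M N) N (X N) T)))"
proof
  assume "\<exists>C::real. \<forall>N\<ge>1. \<forall>T. T \<subseteq> topspace (Euclidean_space N) \<and> finite T \<and> T \<noteq> {} \<longrightarrow>
           (\<exists>y :: nat \<Rightarrow> nat \<Rightarrow> real.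
              (\<forall>k\<ge>1. y k \<in> topspace (Euclidean_space N)) \<and>
              difference_set T \<subseteq> absconv {y k | k. k \<ge> 1} \<and>
              (\<forall>k\<ge>1. Lp_norm (M N) (ln (real k + 2)) (lin_comb N (X N) (y k))
                        \<le> C * exp_sup (M N) N (X N) T))"
  then obtain C where C: "\<forall>N\<ge>1. \<forall>T. T \<subseteq> topspace (Euclidean_space N) \<and> finite T \<and> T \<noteq> {} \<longrightarrow>
           (\<exists>y :: nat \<Rightarrow> nat \<Rightarrow> real.
              (\<forall>k\<ge>1. y k \<in> topspace (Euclidean_space N)) \<and>
              difference_set T \<subseteq> absconv {y k | k. k \<ge> 1} \<and>
              (\<forall>k\<ge>1. Lp_norm (M N) (ln (real k + 2)) (lin_comb N (X N) (y k))
                        \<le> C * exp_sup (M N) N (X N) T))" ..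

  \<comment> \<open>Choice of the constants and of the dimension\<close>
  define D where "D = (\<bar>C\<bar> + 1) * sup_const r"
  \<comment> \<open>\<open>g\<close> collects the factors of the coordinate bound:
    \<open>exp 1\<close> from \<open>coordinate_le_Lp_norm\<close>, \<open>D\<close> from the norms,
    and \<open>8 powr (1 / r)\<close> from \<open>L \<le> 8 * ln R\<close>.\<close>
  define g where "g = exp 1 * D * 8 powr (1 / r)"
  have "0 < sup_const r"
    unfolding sup_const_def by (intro add_pos_nonneg) auto
  then have D0: "0 < D" by (simp add: D_def)
  have g0: "0 < g" using D0 by (simp add: g_def)
  have s0: "0 < 1 / r - 1" using assms(1,2) by simp
  \<comment> \<open>The order of choice matters: \<open>A\<close> and \<open>d\<close> depend on \<open>r\<close> and \<open>C\<close> only, and \<open>R\<close> is taken last, so large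
    that \<open>ln N\<close> is comparable with \<open>ln R\<close> and every power of it is negligible against \<open>R\<close>.\<close>
  obtain A :: nat where A: "2 * g < real A" using reals_Archimedean2 by blast
  \<comment> \<open>Since \<open>1 / r - 1 > 0\<close>, a large \<open>d\<close> gives
    \<open>g < d powr (1 / r - 1)\<close>, which will push all coordinates of \<open>y k\<close>
    below \<open>1\<close> once \<open>k + 2 > R ^ d\<close>.\<close>
  obtain d :: nat where d: "(g + 1) powr (1 / (1 / r - 1)) < real d" using reals_Archimedean2 by blast
  have d0: "0 < d"
    using d powr_ge_zero[of "g + 1" "1 / (1 / r - 1)"] by (cases d) auto
  have gd: "g < real d powr (1 / r - 1)"
  proof -
    have "g < ((g + 1) powr (1 / (1 / r - 1))) powr (1 / r - 1)"
      using g0 assms(1,2) by (simp add: powr_powr)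
    also have "\<dots> \<le> real d powr (1 / r - 1)" using d s0 by (intro powr_mono2) auto
    finally show ?thesis .
  qed
  define m where "m = A * d"
  have m0: "0 < m" using A g0 d0 by (cases A) (auto simp: m_def)
  \<comment> \<open>\<open>K * R\<close> will bound the number of coordinates of size at least
    \<open>1 / 2\<close>; \<open>K < R\<close> makes this at most \<open>R\<^sup>2\<close>.\<close>
  define K where "K = 4 * l2_const r * (D * real d * 8 powr (1 / r))\<^sup>2 * (8 / r) powr (2 / r)"
  obtain R :: nat where R: "max (real (d * m ^ d * m)) (max (exp (real m + 1)) (max K 2)) < real R"
    using reals_Archimedean2 by blast
  define N where "N = d * m ^ d * R ^ 4 * m"
  define L where "L = ln (real N)"
  have R2: "2 < real R" and RK: "K < real R" and Rm: "exp (real m + 1) \<le> real R"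
    and Rd: "real (d * m ^ d * m) \<le> real R"
    using R by auto
  have lnR: "1 \<le> ln (real R)"
  proof -
    have "exp 1 \<le> exp (real m + 1)" by simp
    then have "exp 1 \<le> real R" using Rm by (rule order_trans)
    then show ?thesis using R2 by (subst ln_ge_iff) auto
  qed
  have N1: "1 \<le> N" using d0 m0 R2 by (simp add: N_def Suc_le_eq)
  have L8: "L \<le> 8 * ln (real R)"
  proof -
    have "real N = real (d * m ^ d * m) * real R ^ 4" by (simp add: N_def)
    also have "\<dots> \<le> real R * real R ^ 4" using Rd by (intro mult_right_mono) auto
    also have "\<dots> = real R ^ 5" by (simp add: power_Suc[symmetric])
    also have "\<dots> \<le> real R ^ 8" using R2 by (intro power_increasing) auto
    finally have "L \<le> ln (real R ^ 8)" unfolding L_def using N1 by (intro ln_mono) auto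
    then show ?thesis using R2 by (simp add: ln_realpow)
  qed
  have L0: "0 \<le> L" using N1 by (simp add: L_def)

  \<comment> \<open>The set of graphs and the bounds on the sequence\<close>
  interpret weibull_family "M N" r N "X N"
    using assms N1 by (auto simp: weibull_family_def weibull_family_axioms_def)
  define T :: "(nat \<Rightarrow> real) set"
    where "T = insert (\<lambda>_. 0) (indicator ` graph_code d m ` ({..<d} \<rightarrow>\<^sub>E {..<R ^ 4}))"
  have finT: "finite T" unfolding T_def by (intro finite.insertI finite_imageI finite_PiE) auto
  have subN: "graph_code d m c \<subseteq> {..<N}" if "c \<in> {..<d} \<rightarrow>\<^sub>E {..<R ^ 4}" for c
    using graph_code_less[OF that d0] by (simp add: N_def)
  have "T \<subseteq> topspace (Euclidean_space N)"
    using subN by (fastforce simp: T_def topspace_Euclidean_space indicator_def)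
  moreover have "T \<noteq> {}" by (simp add: T_def)
  ultimately obtain y :: "nat \<Rightarrow> nat \<Rightarrow> real" where
    conv: "difference_set T \<subseteq> absconv {y k | k. k \<ge> 1}" and
    norm: "\<And>k. 1 \<le> k \<Longrightarrow> Lp_norm (M N) (ln (real k + 2)) (lin_comb N (X N) (y k))
      \<le> C * exp_sup (M N) N (X N) T"
    using C[rule_format, OF N1, of T] finT by blast
  define G where "G = D * real d * L powr (1 / r)"
  have q1: "1 \<le> ln (real k + 2)" if "1 \<le> k" for k :: nat
  proof -
    have "exp 1 \<le> real k + 2" using exp_le that by linarith
    then show ?thesis by (subst ln_ge_iff) auto
  qed
  have normG: "Lp_norm (M N) (ln (real k + 2)) (lin_comb N (X N) (y k)) \<le> G" if "1 \<le> k" for k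
  proof -
    \<comment> \<open>\<open>C\<close> may be negative; passing to \<open>\<bar>C\<bar> + 1\<close>
      is sound as the expected supremum is nonnegative, \<open>0\<close> being in
      \<open>T\<close>.\<close>
    have "C * exp_sup (M N) N (X N) T \<le> (\<bar>C\<bar> + 1) * exp_sup (M N) N (X N) T"
      using exp_sup_nonneg[OF finT] by (intro mult_right_mono) (auto simp: T_def)
    also have "\<dots> \<le> (\<bar>C\<bar> + 1) * (sup_const r * real d * L powr (1 / r))"
      unfolding T_def L_def using assms(2) d0 m0 Rm N_def
      by (intro mult_left_mono exp_sup_graph_codes_le) auto
    also have "\<dots> = G" by (simp add: G_def D_def)
    finally show ?thesis using norm[OF that] by linarith
  qed
  have Lp0: "0 \<le> Lp_norm (M N) q Z" for q Z by (simp add: Lp_norm_def)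
  \<comment> \<open>By \<open>R ^ h < k + 2\<close> the order \<open>ln (k + 2)\<close> is at least
    \<open>h * L / 8\<close>; its power \<open>1 / r\<close> gives the decay in
    \<open>h\<close>.\<close>
  have coord: "\<bar>y k i\<bar> \<le> g * real d / real h powr (1 / r)"
    if k: "1 \<le> k" and h: "1 \<le> h" "R ^ h < k + 2" and i: "i < N" for k h i
  proof -
    let ?q = "ln (real k + 2)"
    have "real R ^ h \<le> real k + 2"
      using h(2) by (metis less_imp_le of_nat_add of_nat_le_iff of_nat_numeral of_nat_power)
    then have "ln (real R ^ h) \<le> ?q" using R2 by (subst ln_le_cancel_iff) auto
    then have hq: "real h * ln (real R) \<le> ?q" using R2 by (simp add: ln_realpow)
    have "real h * L \<le> real h * (8 * ln (real R))" using L8 by (intro mult_left_mono) auto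
    also have "\<dots> \<le> 8 * ?q" using hq by simp
    finally have "(real h * L) powr (1 / r) \<le> (8 * ?q) powr (1 / r)"
      using assms(1) L0 by (intro powr_mono2) auto
    then have Lq: "real h powr (1 / r) * L powr (1 / r) \<le> 8 powr (1 / r) * ?q powr (1 / r)"
      using L0 q1[OF k] by (simp add: powr_mult)
    have "\<bar>y k i\<bar> * ?q powr (1 / r) \<le> exp 1 * G"
      using coordinate_le_Lp_norm[OF q1[OF k] i, of "y k"] normG[OF k]
      by (meson exp_ge_zero mult_left_mono order_trans)
    then have "real h powr (1 / r) * (\<bar>y k i\<bar> * ?q powr (1 / r)) \<le> real h powr (1 / r) * (exp 1 * G)"
      by (intro mult_left_mono) auto
    also have "\<dots> = exp 1 * D * real d * (real h powr (1 / r) * L powr (1 / r))"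
      by (simp add: G_def)
    also have "\<dots> \<le> exp 1 * D * real d * (8 powr (1 / r) * ?q powr (1 / r))"
      using D0 by (intro mult_left_mono[OF Lq]) auto
    also have "\<dots> = (g * real d) * ?q powr (1 / r)" by (simp add: g_def)
    finally have "(real h powr (1 / r) * \<bar>y k i\<bar>) * ?q powr (1 / r) \<le> (g * real d) * ?q powr (1 / r)"
      by (simp only: mult.assoc)
    then have "real h powr (1 / r) * \<bar>y k i\<bar> \<le> g * real d"
      using q1[OF k] by (simp add: mult_le_cancel_right)
    then show ?thesis using h(1) by (simp add: pos_le_divide_eq mult.commute)
  qed

  \<comment> \<open>A graph with small sums for every \<open>y k\<close>\<close>
  obtain c where c: "c \<in> {..<d} \<rightarrow>\<^sub>E {..<R ^ 4}"
    and less: "\<And>k. 1 \<le> k \<Longrightarrow> (\<Sum>i\<in>graph_code d m c. \<bar>y k i\<bar>) < m"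
  proof (rule exists_graph_code_avoiding[OF d0 m0 _ N_def, of y])
    show "2 \<le> R" using R2 by simp
    show "card {i. i < N \<and> 1 / 2 \<le> \<bar>y k i\<bar>} \<le> R\<^sup>2" if k: "1 \<le> k" for k
    proof -
      let ?J = "{i. i < N \<and> 1 / 2 \<le> \<bar>y k i\<bar>}"
      have "real (card ?J) * (1 / 4) = (\<Sum>i\<in>?J. 1 / 4)" by simp
      also have "\<dots> \<le> (\<Sum>i\<in>?J. (y k i)\<^sup>2)"
      proof (rule sum_mono)
        fix i assume "i \<in> ?J"
        then have "(1 / 2)\<^sup>2 \<le> \<bar>y k i\<bar>\<^sup>2" by (intro power_mono) auto
        then show "1 / 4 \<le> (y k i)\<^sup>2" by (simp add: power2_eq_square)
      qed
      also have "\<dots> \<le> (\<Sum>i<N. (y k i)\<^sup>2)" by (intro sum_mono2) auto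
      also have "\<dots> \<le> l2_const r * (Lp_norm (M N) (ln (real k + 2)) (lin_comb N (X N) (y k)))\<^sup>2"
        by (rule sum_squares_le_Lp_norm[OF q1[OF k]])
      also have "\<dots> \<le> l2_const r * G\<^sup>2"
        using normG[OF k] Lp0 by (intro mult_left_mono power_mono) (auto simp: l2_const_def)
      finally have "real (card ?J) \<le> 4 * l2_const r * G\<^sup>2" by simp
      also have "\<dots> \<le> 4 * l2_const r * ((D * real d * 8 powr (1 / r))\<^sup>2 * ((8 / r) powr (2 / r) * real R))"
      proof (intro mult_left_mono)
        have "G \<le> D * real d * (8 * ln (real R)) powr (1 / r)"
          unfolding G_def using L0 L8 D0 assms(1) by (intro mult_left_mono powr_mono2) auto
        also have "\<dots> = D * real d * 8 powr (1 / r) * ln (real R) powr (1 / r)"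
          using lnR by (simp add: powr_mult)
        finally have "G\<^sup>2 \<le> (D * real d * 8 powr (1 / r) * ln (real R) powr (1 / r))\<^sup>2"
          using D0 by (intro power_mono) (auto simp: G_def)
        also have "\<dots> = (D * real d * 8 powr (1 / r))\<^sup>2 * ln (real R) powr (2 / r)"
          by (simp add: power_mult_distrib power2_eq_square[of "_ powr _"] powr_add[symmetric])
        \<comment> \<open>The power of the logarithm is traded for a single factor
          \<open>R\<close>.\<close>
        also have "ln (real R) powr (2 / r) \<le> (8 / r) powr (2 / r) * real R"
        proof -
          have "ln (real R) powr (2 / r) \<le> (4 * (2 / r)) powr (2 / r) * exp (ln (real R) / 4)"
            using lnR assms(1) by (intro powr_le_exp_quarter) auto
          also have "\<dots> \<le> (4 * (2 / r)) powr (2 / r) * exp (ln (real R))"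
            using lnR by (intro mult_left_mono) auto
          finally show ?thesis using R2 by simp
        qed
        finally show "G\<^sup>2 \<le> (D * real d * 8 powr (1 / r))\<^sup>2 * ((8 / r) powr (2 / r) * real R)"
          by (simp add: mult_left_mono)
      qed (simp add: l2_const_def)
      also have "\<dots> = K * real R" by (simp add: K_def)
      also have "\<dots> \<le> real R * real R" using RK by (intro mult_right_mono) auto
      finally have "real (card ?J) \<le> real (R\<^sup>2)" by (simp add: power2_eq_square)
      then show ?thesis by (simp only: of_nat_le_iff)
    qed
    show "2 * real h * \<bar>y k i\<bar> < real m"
      if k: "1 \<le> k" and h: "1 \<le> h" "h \<le> d" "R ^ h < k + 2" and i: "i < N" for k h i
    proof -
      \<comment> \<open>The decay \<open>h powr (1 / r)\<close> beats the factor \<open>h\<close>,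
        so \<open>2 * g < A\<close> suffices.\<close>
      have "real h = real h powr 1" using h by simp
      also have "\<dots> \<le> real h powr (1 / r)" using h assms(1,2) by (intro powr_mono) auto
      finally have hp: "real h \<le> real h powr (1 / r)" .
      have "real h * \<bar>y k i\<bar> \<le> real h powr (1 / r) * (g * real d / real h powr (1 / r))"
        using hp coord[OF k h(1,3) i] by (intro mult_mono) auto
      also have "\<dots> = g * real d" using h by simp
      finally have "2 * (real h * \<bar>y k i\<bar>) \<le> (2 * g) * real d" by simp
      also have "\<dots> < real A * real d" using A d0 by (intro mult_strict_right_mono) auto
      finally show ?thesis by (simp add: m_def)
    qed
    show "\<bar>y k i\<bar> < 1" if k: "1 \<le> k" "R ^ d < k + 2" and i: "i < N" for k i
    proof -
      \<comment> \<open>At \<open>h = d\<close> the bound is \<open>g / d powr (1 / r - 1)\<close>,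
        which the choice of \<open>d\<close> made smaller than \<open>1\<close>.\<close>
      have "\<bar>y k i\<bar> \<le> g * real d / real d powr (1 / r)"
        using d0 by (intro coord[OF k(1) _ k(2) i]) simp
      also have "\<dots> = g / real d powr (1 / r - 1)" using d0 by (simp add: powr_diff)
      also have "\<dots> < 1" using gd g0 d0 by (subst divide_less_eq_1_pos) auto
      finally show ?thesis .
    qed
  qed (rule that)

  \<comment> \<open>Contradiction with the absolutely convex hull\<close>
  let ?S = "graph_code d m c"
  have "indicator ?S \<in> T" "(\<lambda>_. 0) \<in> T" using c by (auto simp: T_def)
  then have "(\<lambda>i. indicator ?S i - 0) \<in> difference_set T"
    unfolding difference_set_def by (intro CollectI exI[of _ "indicator ?S"] exI[of _ "\<lambda>_. 0"]) simp
  then have mem: "indicator ?S \<in> absconv {y k | k. k \<ge> 1}" using conv by auto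
  have ne: "?S \<noteq> {}" using card_graph_code[of d m c] m0 by (metis card.empty not_less_zero)
  obtain v where "v \<in> {y k | k. k \<ge> 1}" "real (card ?S) \<le> (\<Sum>i\<in>?S. \<bar>v i\<bar>)"
    by (rule absconv_indicator_witness[OF finite_graph_code ne mem])
  then obtain k where "1 \<le> k" "real m \<le> (\<Sum>i\<in>?S. \<bar>y k i\<bar>)"
    by (auto simp: card_graph_code)
  then show False using less[of k] by simp
qed

end
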